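(* Let $\{G_n: n\in\omega\}$ be a countable family of separable topological groups, each having a local $\omega^\omega$-base. Then the free product $G=\ast_{n\in\omega}G_n$ has a local $\omega^\omega$-base. In particular, this conclusion holds for the free product of countably many Polish groups.
   Context: The set $\omega^\omega$ of all functions $\omega\to\omega$ carries the pointwise partial order. A topological group has a local $\omega^\omega$-base if there is a family $\{U_\alpha:\alpha\in\omega^\omega\}$ of neighbourhoods of the identity such that $\alpha\le\beta$ implies $U_\beta\subseteq U_\alpha$ and every neighbourhood of the identity contains some $U_\alpha$. The free product $\ast_{i\in I}G_i$ of topological groups is the coproduct in the category of topological groups: it is the algebraic free product of the groups $G_i$, equipped with the finest group topology inducing the original topology on each subgroup $G_i$; equivalently, every collection of continuous homomorphisms $h_i\colon G_i\to K$ to a common topological group $K$ uniquely extends to a continuous homomorphism $\ast_{i\in I}G_i\to K$. *)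

theory Defs
  imports "HOL-Analysis.Analysis" "HOL-Algebra.Group"
begin

text \<open>Topological groups are not required to be Hausdorff.\<close>

definition topological_group :: "('a, 'b) monoid_scheme \<Rightarrow> 'a topology \<Rightarrow> bool" where
  "topological_group G T \<longleftrightarrow>
     group G \<and> topspace T = carrier G \<and>
     continuous_map (prod_topology T T) T (\<lambda>(x, y). x \<otimes>\<^bsub>G\<^esub> y) \<and>
     continuous_map T T (\<lambda>x. inv\<^bsub>G\<^esub> x)"

definition polish_group :: "('a, 'b) monoid_scheme \<Rightarrow> 'a topology \<Rightarrow> bool" where
  "polish_group G T \<longleftrightarrow>
     topological_group G T \<and> separable_space T \<and> completely_metrizable_space T"

definition nbhd_of :: "'a topology \<Rightarrow> 'a \<Rightarrow> 'a set \<Rightarrow> bool" where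
  "nbhd_of T x N \<longleftrightarrow> N \<subseteq> topspace T \<and> (\<exists>V. openin T V \<and> x \<in> V \<and> V \<subseteq> N)"

text \<open>The order on \<open>nat \<Rightarrow> nat\<close> is the pointwise one.\<close>

definition has_local_omega_omega_base :: "('a, 'b) monoid_scheme \<Rightarrow> 'a topology \<Rightarrow> bool" where
  "has_local_omega_omega_base G T \<longleftrightarrow>
     (\<exists>U :: (nat \<Rightarrow> nat) \<Rightarrow> 'a set.
        (\<forall>\<alpha>. nbhd_of T \<one>\<^bsub>G\<^esub> (U \<alpha>)) \<and>
        (\<forall>\<alpha> \<beta>. \<alpha> \<le> \<beta> \<longrightarrow> U \<beta> \<subseteq> U \<alpha>) \<and>
        (\<forall>N. nbhd_of T \<one>\<^bsub>G\<^esub> N \<longrightarrow> (\<exists>\<alpha>. U \<alpha> \<subseteq> N)))"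

text \<open>
  The algebraic free product: words in the disjoint union of the groups, modulo the congruence
  that deletes identity letters and multiplies adjacent letters from the same group.
\<close>

definition fp_words :: "'i set \<Rightarrow> ('i \<Rightarrow> ('a, 'b) monoid_scheme) \<Rightarrow> ('i \<times> 'a) list set" where
  "fp_words I G = lists (SIGMA i:I. carrier (G i))"

inductive fp_equiv ::
    "'i set \<Rightarrow> ('i \<Rightarrow> ('a, 'b) monoid_scheme) \<Rightarrow> ('i \<times> 'a) list \<Rightarrow> ('i \<times> 'a) list \<Rightarrow> bool"
  for I G where
  unit: "\<lbrakk>u \<in> fp_words I G; v \<in> fp_words I G; i \<in> I\<rbrakk>
           \<Longrightarrow> fp_equiv I G (u @ [(i, \<one>\<^bsub>G i\<^esub>)] @ v) (u @ v)"
| mult: "\<lbrakk>u \<in> fp_words I G; v \<in> fp_words I G; i \<in> I; x \<in> carrier (G i); y \<in> carrier (G i)\<rbrakk>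
           \<Longrightarrow> fp_equiv I G (u @ [(i, x), (i, y)] @ v) (u @ [(i, x \<otimes>\<^bsub>G i\<^esub> y)] @ v)"
| refl: "u \<in> fp_words I G \<Longrightarrow> fp_equiv I G u u"
| sym: "fp_equiv I G u v \<Longrightarrow> fp_equiv I G v u"
| trans: "\<lbrakk>fp_equiv I G u v; fp_equiv I G v w\<rbrakk> \<Longrightarrow> fp_equiv I G u w"

definition fp_class ::
    "'i set \<Rightarrow> ('i \<Rightarrow> ('a, 'b) monoid_scheme) \<Rightarrow> ('i \<times> 'a) list \<Rightarrow> ('i \<times> 'a) list set" where
  "fp_class I G u = {v. fp_equiv I G u v}"

definition free_product ::
    "'i set \<Rightarrow> ('i \<Rightarrow> ('a, 'b) monoid_scheme) \<Rightarrow> ('i \<times> 'a) list set monoid" where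
  "free_product I G =
     \<lparr>carrier = fp_class I G ` fp_words I G,
      mult = (\<lambda>A B. \<Union>u\<in>A. \<Union>v\<in>B. fp_class I G (u @ v)),
      one = fp_class I G []\<rparr>"

definition fp_incl ::
    "'i set \<Rightarrow> ('i \<Rightarrow> ('a, 'b) monoid_scheme) \<Rightarrow> 'i \<Rightarrow> 'a \<Rightarrow> ('i \<times> 'a) list set" where
  "fp_incl I G i x = fp_class I G [(i, x)]"

text \<open>
  Group topologies on the free product inducing the original topology on each factor, and the
  finest one. The latter is written as the supremum of all of them; that it is itself one of
  them is \<open>free_product_topology_finest\<close> below.
\<close>

definition fp_group_topology ::
    "'i set \<Rightarrow> ('i \<Rightarrow> ('a, 'b) monoid_scheme) \<Rightarrow> ('i \<Rightarrow> 'a topology)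
       \<Rightarrow> ('i \<times> 'a) list set topology \<Rightarrow> bool" where
  "fp_group_topology I G T S \<longleftrightarrow>
     topological_group (free_product I G) S \<and>
     (\<forall>i\<in>I. embedding_map (T i) S (fp_incl I G i))"

definition free_product_topology ::
    "'i set \<Rightarrow> ('i \<Rightarrow> ('a, 'b) monoid_scheme) \<Rightarrow> ('i \<Rightarrow> 'a topology)
       \<Rightarrow> ('i \<times> 'a) list set topology" where
  "free_product_topology I G T =
     topology_generated_by {U. \<exists>S. fp_group_topology I G T S \<and> openin S U}"

lemma fp_words_simps [simp]:
  "[] \<in> fp_words I G"
  "a # u \<in> fp_words I G \<longleftrightarrow> fst a \<in> I \<and> snd a \<in> carrier (G (fst a)) \<and> u \<in> fp_words I G"
  "u @ v \<in> fp_words I G \<longleftrightarrow> u \<in> fp_words I G \<and> v \<in> fp_words I G"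
  by (cases a; auto simp: fp_words_def)+

context
  fixes I :: "'i set" and G :: "'i \<Rightarrow> ('a, 'b) monoid_scheme"
  assumes grp: "\<And>i. i \<in> I \<Longrightarrow> group (G i)"
begin

lemma fp_equiv_words: "fp_equiv I G u v \<Longrightarrow> u \<in> fp_words I G \<and> v \<in> fp_words I G"
proof (induction rule: fp_equiv.induct)
  case (unit u v i)
  then show ?case using grp group.is_monoid monoid.one_closed by fastforce
next
  case (mult u v i x y)
  then show ?case using grp[of i] by (auto simp: group.is_monoid monoid.m_closed)
qed auto

lemma fp_equiv_app_left: "fp_equiv I G u v \<Longrightarrow> w \<in> fp_words I G \<Longrightarrow> fp_equiv I G (w @ u) (w @ v)"
proof (induction rule: fp_equiv.induct)
  case (unit u v i)
  then show ?case using fp_equiv.unit[of "w @ u" I G v i] by auto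
next
  case (mult u v i x y)
  then show ?case using fp_equiv.mult[of "w @ u" I G v i x y] by auto
qed (auto intro: fp_equiv.refl fp_equiv.sym fp_equiv.trans)

lemma fp_equiv_app_right: "fp_equiv I G u v \<Longrightarrow> w \<in> fp_words I G \<Longrightarrow> fp_equiv I G (u @ w) (v @ w)"
proof (induction rule: fp_equiv.induct)
  case (unit u v i)
  then show ?case using fp_equiv.unit[of u I G "v @ w" i] by auto
next
  case (mult u v i x y)
  then show ?case using fp_equiv.mult[of u I G "v @ w" i x y] by auto
qed (auto intro: fp_equiv.refl fp_equiv.sym fp_equiv.trans)

lemma fp_equiv_app:
  "fp_equiv I G u u' \<Longrightarrow> fp_equiv I G v v' \<Longrightarrow> fp_equiv I G (u @ v) (u' @ v')"
  by (meson fp_equiv.trans fp_equiv_app_left fp_equiv_app_right fp_equiv_words)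

lemma fp_class_eq_iff:
  "u \<in> fp_words I G \<Longrightarrow> fp_class I G u = fp_class I G v \<longleftrightarrow> fp_equiv I G u v"
  unfolding fp_class_def using fp_equiv.refl fp_equiv.sym fp_equiv.trans by blast

lemma free_product_mult:
  assumes "u \<in> fp_words I G" "v \<in> fp_words I G"
  shows "fp_class I G u \<otimes>\<^bsub>free_product I G\<^esub> fp_class I G v = fp_class I G (u @ v)"
proof -
  have "fp_class I G (u' @ v') = fp_class I G (u @ v)"
    if "u' \<in> fp_class I G u" "v' \<in> fp_class I G v" for u' v'
    using that assms fp_class_eq_iff[of "u @ v" "u' @ v'"] fp_equiv_app by (auto simp: fp_class_def)
  moreover have "u \<in> fp_class I G u" "v \<in> fp_class I G v"
    using assms by (auto simp: fp_class_def intro: fp_equiv.refl)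
  ultimately have "(\<Union>u'\<in>fp_class I G u. \<Union>v'\<in>fp_class I G v. fp_class I G (u' @ v')) = fp_class I G (u @ v)"
    by blast
  then show ?thesis by (simp add: free_product_def)
qed

lemma free_product_simps:
  "carrier (free_product I G) = fp_class I G ` fp_words I G"
  "\<one>\<^bsub>free_product I G\<^esub> = fp_class I G []"
  by (simp_all add: free_product_def)

lemma fp_class_in_carrier: "u \<in> fp_words I G \<Longrightarrow> fp_class I G u \<in> carrier (free_product I G)"
  by (simp add: free_product_simps)

lemma fp_left_inverse:
  "u \<in> fp_words I G \<Longrightarrow> \<exists>v\<in>fp_words I G. fp_equiv I G (v @ u) []"
proof (induction u)
  case Nil
  then show ?case by (auto intro!: bexI[of _ "[]"] fp_equiv.refl)
next
  case (Cons a u)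
  obtain i x where a: "a = (i, x)" by fastforce
  with Cons have i: "i \<in> I" and x: "x \<in> carrier (G i)" and u: "u \<in> fp_words I G" by auto
  interpret group "G i" using grp i by blast
  obtain v where v: "v \<in> fp_words I G" "fp_equiv I G (v @ u) []" using Cons.IH u by blast
  let ?w = "v @ [(i, inv\<^bsub>G i\<^esub> x)]"
  have "fp_equiv I G (?w @ a # u) (v @ [(i, \<one>\<^bsub>G i\<^esub>)] @ u)"
    using fp_equiv.mult[of v I G u i "inv\<^bsub>G i\<^esub> x" x] v u i x by (simp add: a)
  then have "fp_equiv I G (?w @ a # u) []"
    using fp_equiv.unit[OF v(1) u i] v(2) by (blast intro: fp_equiv.trans)
  moreover have "?w \<in> fp_words I G" using v i x by simp
  ultimately show ?case by blast
qed

lemma group_free_product: "group (free_product I G)"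
proof (rule groupI)
  fix A assume "A \<in> carrier (free_product I G)"
  then obtain u where u: "u \<in> fp_words I G" "A = fp_class I G u" by (auto simp: free_product_simps)
  obtain v where v: "v \<in> fp_words I G" "fp_equiv I G (v @ u) []" using fp_left_inverse u by blast
  have "fp_class I G v \<otimes>\<^bsub>free_product I G\<^esub> A = \<one>\<^bsub>free_product I G\<^esub>"
    using u v by (simp add: free_product_mult fp_class_eq_iff free_product_simps)
  then show "\<exists>B\<in>carrier (free_product I G). B \<otimes>\<^bsub>free_product I G\<^esub> A = \<one>\<^bsub>free_product I G\<^esub>"
    using v fp_class_in_carrier by blast
qed (auto simp: free_product_simps free_product_mult)

lemma fp_incl_hom: "i \<in> I \<Longrightarrow> fp_incl I G i \<in> hom (G i) (free_product I G)"
proof (rule homI)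
  fix x y assume i: "i \<in> I" and xy: "x \<in> carrier (G i)" "y \<in> carrier (G i)"
  then have eq: "fp_equiv I G [(i, x), (i, y)] [(i, x \<otimes>\<^bsub>G i\<^esub> y)]"
    using fp_equiv.mult[of "[]" I G "[]" i x y] by simp
  have w: "[(i, x), (i, y)] \<in> fp_words I G" using i xy by simp
  have "fp_incl I G i x \<otimes>\<^bsub>free_product I G\<^esub> fp_incl I G i y = fp_class I G [(i, x), (i, y)]"
    unfolding fp_incl_def using i xy by (subst free_product_mult) auto
  also have "\<dots> = fp_incl I G i (x \<otimes>\<^bsub>G i\<^esub> y)"
    unfolding fp_incl_def using fp_class_eq_iff[OF w] eq by blast
  finally show "fp_incl I G i (x \<otimes>\<^bsub>G i\<^esub> y) =
      fp_incl I G i x \<otimes>\<^bsub>free_product I G\<^esub> fp_incl I G i y" ..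
qed (simp add: fp_incl_def fp_class_in_carrier)

lemma free_product_extend:
  fixes K :: "('c, 'd) monoid_scheme"
  assumes K: "group K" and h: "\<And>i. i \<in> I \<Longrightarrow> h i \<in> hom (G i) K"
  shows "\<exists>f\<in>hom (free_product I G) K. \<forall>i\<in>I. \<forall>x\<in>carrier (G i). f (fp_incl I G i x) = h i x"
proof -
  interpret K: group K by (rule K)
  define ev where "ev u = foldr (\<lambda>(i, x) a. h i x \<otimes>\<^bsub>K\<^esub> a) u \<one>\<^bsub>K\<^esub>" for u
  have hc: "h i x \<in> carrier K" if "i \<in> I" "x \<in> carrier (G i)" for i x
    using h that by (auto simp: hom_def)
  have ev_c: "ev u \<in> carrier K" if "u \<in> fp_words I G" for u
    using that by (induction u) (auto simp: ev_def hc)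
  have ev_Cons: "ev ((i, x) # u) = h i x \<otimes>\<^bsub>K\<^esub> ev u" for i x u by (simp add: ev_def)
  have ev_app: "ev (u @ v) = ev u \<otimes>\<^bsub>K\<^esub> ev v" if "u \<in> fp_words I G" "v \<in> fp_words I G" for u v
    using that
  proof (induction u)
    case Nil
    then show ?case using ev_c by (simp add: ev_def)
  next
    case (Cons a u)
    then show ?case by (cases a) (simp add: ev_Cons K.m_assoc ev_c hc)
  qed
  have ev_eq: "fp_equiv I G u v \<Longrightarrow> ev u = ev v" for u v
  proof (induction rule: fp_equiv.induct)
    case (unit u v i)
    have "h i \<one>\<^bsub>G i\<^esub> = \<one>\<^bsub>K\<^esub>" using hom_one[OF h grp K] unit by blast
    moreover have "(i, \<one>\<^bsub>G i\<^esub>) # v \<in> fp_words I G"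
      using unit grp by (simp add: group.is_monoid monoid.one_closed)
    ultimately show ?case using unit by (simp add: ev_app ev_Cons ev_c)
  next
    case (mult u v i x y)
    have "h i (x \<otimes>\<^bsub>G i\<^esub> y) = h i x \<otimes>\<^bsub>K\<^esub> h i y" using h mult by (auto simp: hom_def)
    moreover have "x \<otimes>\<^bsub>G i\<^esub> y \<in> carrier (G i)"
      using mult grp by (simp add: group.is_monoid monoid.m_closed)
    ultimately show ?case using mult by (simp add: ev_app ev_Cons ev_c hc K.m_assoc)
  qed auto
  define f where "f A = ev (SOME u. u \<in> A)" for A
  have f: "f (fp_class I G u) = ev u" if "u \<in> fp_words I G" for u
  proof -
    have "u \<in> fp_class I G u" using that by (simp add: fp_class_def fp_equiv.refl)
    then have "(SOME v. v \<in> fp_class I G u) \<in> fp_class I G u" by (rule someI)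
    then show ?thesis using ev_eq by (force simp: f_def fp_class_def)
  qed
  have "f \<in> hom (free_product I G) K"
    by (rule homI) (auto simp: free_product_simps f ev_c free_product_mult ev_app)
  moreover have "f (fp_incl I G i x) = h i x" if "i \<in> I" "x \<in> carrier (G i)" for i x
  proof -
    have "f (fp_incl I G i x) = ev [(i, x)]" using that by (simp add: fp_incl_def f)
    then show ?thesis using that hc by (simp add: ev_def)
  qed
  ultimately show ?thesis by blast
qed

end

lemma continuous_map_into_sup:
  assumes "\<F> \<noteq> {}" "\<And>S. S \<in> \<F> \<Longrightarrow> continuous_map X S f"
  shows "continuous_map X (topology_generated_by {U. \<exists>S\<in>\<F>. openin S U}) f"
proof (rule continuous_on_generated_topo)
  fix V assume "V \<in> {U. \<exists>S\<in>\<F>. openin S U}"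
  then show "openin X (f -` V \<inter> topspace X)" using assms(2) by (auto simp: continuous_map_alt)
next
  obtain S where S: "S \<in> \<F>" using assms(1) by blast
  then have "f ` topspace X \<subseteq> topspace S" using assms(2) by (auto simp: continuous_map_def)
  moreover have "topspace S \<in> {U. \<exists>S\<in>\<F>. openin S U}" using S by blast
  ultimately show "f ` topspace X \<subseteq> \<Union>{U. \<exists>S\<in>\<F>. openin S U}" by blast
qed

lemma topological_group_sup:
  assumes F: "\<F> \<noteq> {}" and top: "\<And>S. S \<in> \<F> \<Longrightarrow> topological_group H S"
  shows "topological_group H (topology_generated_by {U. \<exists>S\<in>\<F>. openin S U})"
proof -
  let ?T = "topology_generated_by {U. \<exists>S\<in>\<F>. openin S U}"
  have H: "group H" using F top by (auto simp: topological_group_def)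
  have sp: "topspace S = carrier H" if "S \<in> \<F>" for S using top that by (simp add: topological_group_def)
  have U: "\<Union>{U. \<exists>S\<in>\<F>. openin S U} = carrier H"
  proof
    show "\<Union>{U. \<exists>S\<in>\<F>. openin S U} \<subseteq> carrier H" using sp openin_subset by blast
    obtain S where "S \<in> \<F>" using F by blast
    then have "carrier H \<in> {U. \<exists>S\<in>\<F>. openin S U}" 
      using sp openin_topspace by (metis (mono_tags, lifting) mem_Collect_eq)
    then show "carrier H \<subseteq> \<Union>{U. \<exists>S\<in>\<F>. openin S U}" by blast
  qed
  have tsp: "topspace ?T = carrier H" by (simp only: topology_generated_by_topspace U)
  have id: "continuous_map ?T S id" if "S \<in> \<F>" for S
  proof -
    have "openin ?T V" if "openin S V" for V
      using that \<open>S \<in> \<F>\<close> by (blast intro: topology_generated_by_Basis)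
    moreover have "{x \<in> carrier H. x \<in> V} = V" if "openin S V" for V
      using openin_subset[OF that] sp[OF \<open>S \<in> \<F>\<close>] by auto
    ultimately show ?thesis
      unfolding continuous_map_def tsp sp[OF that] by (simp only: id_apply) auto
  qed
  have "continuous_map (prod_topology ?T ?T) ?T (\<lambda>(x, y). x \<otimes>\<^bsub>H\<^esub> y)"
  proof (rule continuous_map_into_sup[OF F])
    fix S assume S: "S \<in> \<F>"
    have "continuous_map (prod_topology ?T ?T) (prod_topology S S) (\<lambda>p. (id (fst p), id (snd p)))"
      by (intro continuous_map_paired[THEN iffD2] conjI
          continuous_map_compose[OF continuous_map_fst id[OF S], unfolded o_def]
          continuous_map_compose[OF continuous_map_snd id[OF S], unfolded o_def])
    then have "continuous_map (prod_topology ?T ?T) (prod_topology S S) id" by (simp add: id_def)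
    moreover have "continuous_map (prod_topology S S) S (\<lambda>(x, y). x \<otimes>\<^bsub>H\<^esub> y)"
      using top[OF S] by (simp add: topological_group_def)
    ultimately show "continuous_map (prod_topology ?T ?T) S (\<lambda>(x, y). x \<otimes>\<^bsub>H\<^esub> y)"
      using continuous_map_compose by fastforce
  qed
  moreover have "continuous_map ?T ?T (\<lambda>x. inv\<^bsub>H\<^esub> x)"
  proof (rule continuous_map_into_sup[OF F])
    fix S assume S: "S \<in> \<F>"
    have "continuous_map S S (\<lambda>x. inv\<^bsub>H\<^esub> x)" using top[OF S] by (simp add: topological_group_def)
    then show "continuous_map ?T S (\<lambda>x. inv\<^bsub>H\<^esub> x)"
      using continuous_map_compose[OF id[OF S]] by fastforce
  qed
  ultimately show ?thesis using H tsp by (simp add: topological_group_def)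
qed

lemma topological_group_pullback:
  assumes H: "group H" and K: "topological_group K T" and f: "f \<in> hom H K"
  shows "topological_group H (pullback_topology (carrier H) f T)"
proof -
  let ?P = "pullback_topology (carrier H) f T"
  interpret f: group_hom H K f
    using H K f by (simp add: group_hom_def group_hom_axioms_def topological_group_def)
  have T: "topspace T = carrier K"
    and m: "continuous_map (prod_topology T T) T (\<lambda>(x, y). x \<otimes>\<^bsub>K\<^esub> y)"
    and i: "continuous_map T T (\<lambda>x. inv\<^bsub>K\<^esub> x)"
    using K by (auto simp: topological_group_def)
  have P: "topspace ?P = carrier H" using f T by (auto simp: topspace_pullback_topology hom_def)
  have fc: "continuous_map ?P T f" using continuous_map_pullback[OF continuous_map_id] by simp
  have "continuous_map (prod_topology ?P ?P) (prod_topology T T) (\<lambda>p. (f (fst p), f (snd p)))"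
    by (intro continuous_map_paired[THEN iffD2] conjI
        continuous_map_compose[OF continuous_map_fst fc, unfolded o_def]
        continuous_map_compose[OF continuous_map_snd fc, unfolded o_def])
  from continuous_map_compose[OF this m]
  have "continuous_map (prod_topology ?P ?P) T (f \<circ> (\<lambda>(x, y). x \<otimes>\<^bsub>H\<^esub> y))"
    by (rule continuous_map_eq) (auto simp: P)
  then have 1: "continuous_map (prod_topology ?P ?P) ?P (\<lambda>(x, y). x \<otimes>\<^bsub>H\<^esub> y)"
    by (rule continuous_map_pullback') (auto simp: P)
  from continuous_map_compose[OF fc i]
  have "continuous_map ?P T (f \<circ> (\<lambda>x. inv\<^bsub>H\<^esub> x))"
    by (rule continuous_map_eq) (auto simp: P)
  then have "continuous_map ?P ?P (\<lambda>x. inv\<^bsub>H\<^esub> x)"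
    by (rule continuous_map_pullback') (auto simp: P)
  with 1 H P show ?thesis by (simp add: topological_group_def)
qed

lemma embedding_map_sup:
  assumes cont: "\<And>S. S \<in> \<F> \<Longrightarrow> continuous_map X S f"
    and S: "S \<in> \<F>" "embedding_map X S f"
  shows "embedding_map X (topology_generated_by {U. \<exists>S\<in>\<F>. openin S U}) f"
proof -
  let ?T = "topology_generated_by {U. \<exists>S\<in>\<F>. openin S U}"
  have S_T: "openin ?T U" if "openin S U" for U
    using that S(1) by (blast intro: topology_generated_by_Basis)
  have fX: "f ` topspace X \<subseteq> topspace S" using cont[OF S(1)] by (auto simp: continuous_map_def)
  have T: "topspace S \<subseteq> topspace ?T" using S_T openin_subset openin_topspace by blast
  have "continuous_map X ?T f"
    by (rule continuous_map_into_sup) (use S(1) cont in auto)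
  then have c: "continuous_map X (subtopology ?T (f ` topspace X)) f"
    by (simp add: continuous_map_in_subtopology)
  have hS: "homeomorphic_map X (subtopology S (f ` topspace X)) f"
    using S(2) by (simp add: embedding_map_def)
  then have inj: "inj_on f (topspace X)" by (rule homeomorphic_imp_injective_map)
  have "open_map X (subtopology ?T (f ` topspace X)) f"
    unfolding open_map_def
  proof (intro allI impI)
    fix U assume "openin X U"
    then have "openin (subtopology S (f ` topspace X)) (f ` U)"
      using hS homeomorphic_imp_open_map open_map_def by metis
    then show "openin (subtopology ?T (f ` topspace X)) (f ` U)"
      using S_T by (auto simp: openin_subtopology)
  qed
  moreover have "f ` topspace X = topspace (subtopology ?T (f ` topspace X))"
    using fX T by (simp only: topspace_subtopology) blast
  ultimately show ?thesis
    unfolding embedding_map_def by (intro bijective_open_imp_homeomorphic_map[OF c _ _ inj])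
qed

context
  fixes I :: "'i set" and G :: "'i \<Rightarrow> ('a, 'b) monoid_scheme" and T :: "'i \<Rightarrow> 'a topology"
  assumes top: "\<And>i. i \<in> I \<Longrightarrow> topological_group (G i) (T i)"
begin

private lemma grp: "i \<in> I \<Longrightarrow> group (G i)"
  using top by (simp add: topological_group_def)

private lemma sp: "i \<in> I \<Longrightarrow> topspace (T i) = carrier (G i)"
  using top by (simp add: topological_group_def)

lemma fp_group_topology_exists: "\<exists>S. fp_group_topology I G T S"
proof -
  let ?F = "free_product I G"
  note F = group_free_product[of I G, OF grp]
  have "\<exists>r\<in>hom ?F (G j). \<forall>i\<in>I. \<forall>x\<in>carrier (G i).
          r (fp_incl I G i x) = (if i = j then x else \<one>\<^bsub>G j\<^esub>)" if "j \<in> I" for j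
  proof (rule free_product_extend[of I G "G j", OF grp grp[OF that]])
    show "(\<lambda>x. if i = j then x else \<one>\<^bsub>G j\<^esub>) \<in> hom (G i) (G j)" if "i \<in> I" for i
      using grp[OF \<open>j \<in> I\<close>] by (auto simp: hom_def group.is_monoid monoid.one_closed monoid.l_one)
  qed
  then obtain r where r: "\<And>j. j \<in> I \<Longrightarrow> r j \<in> hom ?F (G j)"
    and r_incl: "\<And>j i x. \<lbrakk>j \<in> I; i \<in> I; x \<in> carrier (G i)\<rbrakk> \<Longrightarrow>
           r j (fp_incl I G i x) = (if i = j then x else \<one>\<^bsub>G j\<^esub>)"
    by metis
  define triv where "triv = pullback_topology (carrier ?F) (\<lambda>_. ()) (discrete_topology {()})"
  define P where "P j = pullback_topology (carrier ?F) (r j) (T j)" for j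
  have tg_triv: "topological_group ?F triv"
    unfolding triv_def
  proof (rule topological_group_pullback[OF F, where K = "\<lparr>carrier = {()}, mult = \<lambda>_ _. (), one = ()\<rparr>"])
    let ?K = "\<lparr>carrier = {()}, mult = \<lambda>_ _. (), one = ()\<rparr> :: unit monoid"
    have "group ?K" by (rule groupI) auto
    then show "topological_group ?K (discrete_topology {()})"
      by (auto simp: topological_group_def continuous_map_def openin_prod_topology_alt)
  qed (auto simp: hom_def)
  have tg_P: "topological_group ?F (P j)" if "j \<in> I" for j
    unfolding P_def using topological_group_pullback[OF F top[OF that] r[OF that]] .
  let ?\<F> = "insert triv (P ` I)"
  have incl_c: "fp_incl I G i x \<in> carrier ?F" if "i \<in> I" "x \<in> carrier (G i)" for i x
    using fp_incl_hom[of I G, OF grp] that by (auto simp: hom_def)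
  have c_triv: "continuous_map (T i) triv (fp_incl I G i)" if "i \<in> I" for i
    unfolding triv_def by (rule continuous_map_pullback') (auto simp: sp that incl_c)
  have c_P: "continuous_map (T i) (P j) (fp_incl I G i)" if "i \<in> I" "j \<in> I" for i j
    unfolding P_def
  proof (rule continuous_map_pullback')
    have "\<one>\<^bsub>G j\<^esub> \<in> topspace (T j)" using grp sp \<open>j \<in> I\<close> by (simp add: group.is_monoid monoid.one_closed)
    then have "continuous_map (T i) (T j) (\<lambda>x. if i = j then x else \<one>\<^bsub>G j\<^esub>)"
      by (cases "i = j") auto
    then show "continuous_map (T i) (T j) (r j \<circ> fp_incl I G i)"
      by (rule continuous_map_eq) (auto simp: r_incl sp that)
  qed (auto simp: sp that incl_c)
  have e_P: "embedding_map (T i) (P i) (fp_incl I G i)" if i: "i \<in> I" for i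
  proof -
    have "continuous_map (P i) (T i) (r i)"
      unfolding P_def using continuous_map_pullback[OF continuous_map_id] by simp
    then have "homeomorphic_maps (T i) (subtopology (P i) (fp_incl I G i ` topspace (T i)))
        (fp_incl I G i) (r i)"
      unfolding homeomorphic_maps_def
      using c_P[OF i i] by (auto simp: continuous_map_in_subtopology continuous_map_from_subtopology r_incl sp i)
    then show ?thesis by (auto simp: embedding_map_def homeomorphic_map_maps)
  qed
  let ?S = "topology_generated_by {U. \<exists>S\<in>?\<F>. openin S U}"
  have "topological_group ?F ?S"
    by (rule topological_group_sup) (use tg_triv tg_P in auto)
  moreover have "embedding_map (T i) ?S (fp_incl I G i)" if i: "i \<in> I" for i
    by (rule embedding_map_sup[where S = "P i"]) (use i c_triv c_P e_P in auto)
  ultimately show ?thesis by (auto simp: fp_group_topology_def)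
qed

theorem free_product_topology_finest:
  "fp_group_topology I G T (free_product_topology I G T)"
  "fp_group_topology I G T S \<Longrightarrow> openin S U \<Longrightarrow> openin (free_product_topology I G T) U"
proof -
  let ?\<F> = "{S. fp_group_topology I G T S}"
  have eq: "free_product_topology I G T = topology_generated_by {U. \<exists>S\<in>?\<F>. openin S U}"
    by (simp add: free_product_topology_def)
  have cont: "continuous_map (T i) S (fp_incl I G i)"
    if "embedding_map (T i) S (fp_incl I G i)" for S i
    using homeomorphic_imp_continuous_map[OF that[unfolded embedding_map_def]]
    by (rule continuous_map_into_fulltopology)
  obtain S0 where S0: "S0 \<in> ?\<F>" using fp_group_topology_exists by blast
  have "topological_group (free_product I G) (free_product_topology I G T)"
    unfolding eq by (rule topological_group_sup) (use S0 in \<open>auto simp: fp_group_topology_def\<close>)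
  moreover have "embedding_map (T i) (free_product_topology I G T) (fp_incl I G i)" if "i \<in> I" for i
    unfolding eq
    by (rule embedding_map_sup[OF _ S0])
       (use S0 that cont in \<open>auto simp: fp_group_topology_def\<close>)
  ultimately show "fp_group_topology I G T (free_product_topology I G T)"
    by (simp add: fp_group_topology_def)
  show "openin (free_product_topology I G T) U" if "fp_group_topology I G T S" "openin S U"
    unfolding free_product_topology_def by (rule topology_generated_by_Basis) (use that in blast)
qed

end

end

theory Submission
  imports Defs
begin

text \<open>
  Choose countable dense sets in the factors and let \<open>D\<close> be the countable submonoid of the free
  product that they generate. For neighbourhoods \<open>V k i d\<close> of the identity in the \<open>i\<close>-th factor, where
  \<open>k\<close> is a natural number and \<open>d \<in> D\<close>, consider all products of elements \<open>d x d\<inverse>\<close> with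
  \<open>x \<in> V k i d\<close>, the indices \<open>k\<close> of the letters being pairwise distinct. By density of \<open>D\<close> these sets
  form a neighbourhood base of a group topology for which the inclusions are continuous, so they are
  neighbourhoods of the identity in the finest such topology. Conversely, a sequence of
  neighbourhoods \<open>W\<close> with \<open>W (k + 1)\<^sup>3 \<subseteq> W k\<close> shows that every neighbourhood contains one of
  them. As the index set of the families \<open>V\<close> is countable, bases of the factors indexed by
  \<open>nat \<Rightarrow> nat\<close> combine into one base indexed by \<open>nat \<Rightarrow> nat\<close>.
\<close>

section \<open>Neighbourhoods of the identity\<close>

lemma nbhd_ofI: "openin T V \<Longrightarrow> x \<in> V \<Longrightarrow> V \<subseteq> N \<Longrightarrow> N \<subseteq> topspace T \<Longrightarrow> nbhd_of T x N"
  by (auto simp: nbhd_of_def)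

lemma nbhd_ofD: "nbhd_of T x N \<Longrightarrow> x \<in> N" "nbhd_of T x N \<Longrightarrow> N \<subseteq> topspace T"
  by (auto simp: nbhd_of_def)

lemma nbhd_of_openin: "openin T V \<Longrightarrow> x \<in> V \<Longrightarrow> nbhd_of T x V"
  by (simp add: nbhd_ofI openin_subset)

lemma nbhd_of_Int: "nbhd_of T x M \<Longrightarrow> nbhd_of T x N \<Longrightarrow> nbhd_of T x (M \<inter> N)"
  unfolding nbhd_of_def by (metis Int_iff Int_mono le_infI1 openin_Int)

lemma nbhd_of_continuous_map:
  assumes "continuous_map T S f" "x \<in> topspace T" "nbhd_of S (f x) N"
  shows "nbhd_of T x {y \<in> topspace T. f y \<in> N}"
proof -
  obtain V where V: "openin S V" "f x \<in> V" "V \<subseteq> N" using assms(3) by (auto simp: nbhd_of_def)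
  then have "openin T {y \<in> topspace T. f y \<in> V}"
    using assms(1) openin_continuous_map_preimage by blast
  then show ?thesis by (rule nbhd_ofI) (use V assms(2) in auto)
qed

lemma topological_group_mult_nbhd:
  assumes T: "topological_group G T" and N: "nbhd_of T \<one>\<^bsub>G\<^esub> N"
  shows "\<exists>M. nbhd_of T \<one>\<^bsub>G\<^esub> M \<and> (\<forall>x\<in>M. \<forall>y\<in>M. x \<otimes>\<^bsub>G\<^esub> y \<in> N)"
proof -
  have sp: "topspace T = carrier G" and m: "continuous_map (prod_topology T T) T (\<lambda>(x, y). x \<otimes>\<^bsub>G\<^esub> y)"
    using T by (auto simp: topological_group_def)
  interpret group G using T by (simp add: topological_group_def)
  obtain V where V: "openin T V" "\<one>\<^bsub>G\<^esub> \<in> V" "V \<subseteq> N" using N by (auto simp: nbhd_of_def)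
  let ?W = "{p \<in> topspace (prod_topology T T). (case p of (x, y) \<Rightarrow> x \<otimes>\<^bsub>G\<^esub> y) \<in> V}"
  have "openin (prod_topology T T) ?W" using m V(1) by (rule openin_continuous_map_preimage)
  moreover have "(\<one>\<^bsub>G\<^esub>, \<one>\<^bsub>G\<^esub>) \<in> ?W" using V sp by auto
  ultimately obtain A B where AB: "openin T A" "openin T B" "\<one>\<^bsub>G\<^esub> \<in> A" "\<one>\<^bsub>G\<^esub> \<in> B" "A \<times> B \<subseteq> ?W"
    unfolding openin_prod_topology_alt by meson
  have "nbhd_of T \<one>\<^bsub>G\<^esub> (A \<inter> B)" using AB by (intro nbhd_of_openin) auto
  moreover have "\<forall>x\<in>A \<inter> B. \<forall>y\<in>A \<inter> B. x \<otimes>\<^bsub>G\<^esub> y \<in> N" using AB(5) V(3) by auto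
  ultimately show ?thesis by blast
qed

text \<open>Halving twice gives \<open>M\<close> with \<open>M * M\<close> inside \<open>N\<close>
  and \<open>L\<close> with \<open>L * L\<close> inside \<open>M\<close>; on the intersection the
  inner product lies in \<open>M\<close> and the outer one in \<open>N\<close>. Three factors are
  wanted because a word will be cut into a part before a letter, the letter, and a part after
  it.\<close>

lemma topological_group_mult3_nbhd:
  assumes T: "topological_group G T" and N: "nbhd_of T \<one>\<^bsub>G\<^esub> N"
  shows "\<exists>M. nbhd_of T \<one>\<^bsub>G\<^esub> M \<and> (\<forall>x\<in>M. \<forall>y\<in>M. \<forall>z\<in>M. x \<otimes>\<^bsub>G\<^esub> (y \<otimes>\<^bsub>G\<^esub> z) \<in> N)"
proof -
  obtain M where M: "nbhd_of T \<one>\<^bsub>G\<^esub> M" "\<forall>x\<in>M. \<forall>y\<in>M. x \<otimes>\<^bsub>G\<^esub> y \<in> N"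
    using topological_group_mult_nbhd[OF T N] by blast
  obtain L where L: "nbhd_of T \<one>\<^bsub>G\<^esub> L" "\<forall>x\<in>L. \<forall>y\<in>L. x \<otimes>\<^bsub>G\<^esub> y \<in> M"
    using topological_group_mult_nbhd[OF T M(1)] by blast
  show ?thesis
    using M(2) L(2) nbhd_of_Int[OF M(1) L(1)] by (intro exI[of _ "M \<inter> L"]) auto
qed

lemma topological_group_inv_nbhd:
  assumes T: "topological_group G T" and N: "nbhd_of T \<one>\<^bsub>G\<^esub> N"
  shows "nbhd_of T \<one>\<^bsub>G\<^esub> {x \<in> carrier G. inv\<^bsub>G\<^esub> x \<in> N}"
proof -
  interpret group G using T by (simp add: topological_group_def)
  show ?thesis
    using nbhd_of_continuous_map[of T T "\<lambda>x. inv\<^bsub>G\<^esub> x" "\<one>\<^bsub>G\<^esub>" N] T N by (simp add: topological_group_def)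
qed

lemma topological_group_continuous_translations:
  assumes T: "topological_group G T" and x: "x \<in> carrier G"
  shows "continuous_map T T (\<lambda>y. x \<otimes>\<^bsub>G\<^esub> y)" "continuous_map T T (\<lambda>y. y \<otimes>\<^bsub>G\<^esub> x)"
proof -
  have sp: "topspace T = carrier G" and m: "continuous_map (prod_topology T T) T (\<lambda>(x, y). x \<otimes>\<^bsub>G\<^esub> y)"
    using T by (auto simp: topological_group_def)
  have "continuous_map T (prod_topology T T) (\<lambda>y. (x, y))"
    "continuous_map T (prod_topology T T) (\<lambda>y. (y, x))"
    using x sp by (simp_all add: continuous_map_pairedI)
  from this[THEN continuous_map_compose, OF m]
  show "continuous_map T T (\<lambda>y. x \<otimes>\<^bsub>G\<^esub> y)" "continuous_map T T (\<lambda>y. y \<otimes>\<^bsub>G\<^esub> x)"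
    by (simp_all add: o_def)
qed

lemma topological_group_conj_nbhd:
  assumes T: "topological_group G T" and x: "x \<in> carrier G" and N: "nbhd_of T \<one>\<^bsub>G\<^esub> N"
  shows "nbhd_of T \<one>\<^bsub>G\<^esub> {y \<in> carrier G. x \<otimes>\<^bsub>G\<^esub> y \<otimes>\<^bsub>G\<^esub> inv\<^bsub>G\<^esub> x \<in> N}"
proof -
  interpret group G using T by (simp add: topological_group_def)
  have "continuous_map T T (\<lambda>y. x \<otimes>\<^bsub>G\<^esub> y \<otimes>\<^bsub>G\<^esub> inv\<^bsub>G\<^esub> x)"
    using continuous_map_compose[OF topological_group_continuous_translations(1)[OF T x]
        topological_group_continuous_translations(2)[OF T inv_closed[OF x]]] by (simp add: o_def)
  from nbhd_of_continuous_map[OF this, of "\<one>\<^bsub>G\<^esub>" N] show ?thesis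
    using T N x by (simp add: topological_group_def)
qed

text \<open>Translations are homeomorphisms and \<open>f\<close> intertwines them:
  \<open>f y\<close> is \<open>f x\<close> times the image of \<open>inv x * y\<close>, so smallness
  near the identity is carried to every point \<open>x\<close>.\<close>

lemma continuous_map_hom_if_continuous_at_one:
  assumes T: "topological_group G T" and S: "topological_group H S" and f: "f \<in> hom G H"
    and one: "\<And>N. nbhd_of S \<one>\<^bsub>H\<^esub> N \<Longrightarrow> \<exists>M. nbhd_of T \<one>\<^bsub>G\<^esub> M \<and> f ` M \<subseteq> N"
  shows "continuous_map T S f"
proof -
  interpret G: group G using T by (simp add: topological_group_def)
  interpret H: group H using S by (simp add: topological_group_def)
  have sp: "topspace T = carrier G" "topspace S = carrier H"
    using T S by (auto simp: topological_group_def)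
  have fc: "f x \<in> carrier H" if "x \<in> carrier G" for x using f that by (auto simp: hom_def)
  have "openin T {x \<in> topspace T. f x \<in> U}" if U: "openin S U" for U
  proof (subst openin_subopen, intro ballI)
    fix x assume "x \<in> {x \<in> topspace T. f x \<in> U}"
    then have x: "x \<in> carrier G" "f x \<in> U" using sp by auto
    have "nbhd_of S \<one>\<^bsub>H\<^esub> {h \<in> topspace S. f x \<otimes>\<^bsub>H\<^esub> h \<in> U}"
      using topological_group_continuous_translations(1)[OF S fc[OF x(1)]] _
        nbhd_of_openin[OF U] by (rule nbhd_of_continuous_map) (use x fc sp in auto)
    then obtain M where M: "nbhd_of T \<one>\<^bsub>G\<^esub> M" "f ` M \<subseteq> {h \<in> topspace S. f x \<otimes>\<^bsub>H\<^esub> h \<in> U}"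
      using one by blast
    then obtain V where V: "openin T V" "\<one>\<^bsub>G\<^esub> \<in> V" "V \<subseteq> M" by (auto simp: nbhd_of_def)
    \<comment> \<open>This is the left translate of \<open>V\<close> by \<open>x\<close>, written as
      a preimage so that its openness follows from continuity of translation.\<close>
    let ?W = "{y \<in> topspace T. inv\<^bsub>G\<^esub> x \<otimes>\<^bsub>G\<^esub> y \<in> V}"
    have "openin T ?W"
      using topological_group_continuous_translations(1)[OF T G.inv_closed[OF x(1)]] V(1)
      by (rule openin_continuous_map_preimage)
    moreover have "x \<in> ?W" using x V sp by simp
    moreover have "?W \<subseteq> {x \<in> topspace T. f x \<in> U}"
    proof
      fix y assume y: "y \<in> ?W"
      then have "f x \<otimes>\<^bsub>H\<^esub> f (inv\<^bsub>G\<^esub> x \<otimes>\<^bsub>G\<^esub> y) \<in> U" using V M by auto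
      moreover have "f x \<otimes>\<^bsub>H\<^esub> f (inv\<^bsub>G\<^esub> x \<otimes>\<^bsub>G\<^esub> y) = f y"
        using x y sp by (simp add: hom_mult[OF f, symmetric] G.m_assoc[symmetric])
      ultimately show "y \<in> {x \<in> topspace T. f x \<in> U}" using y by simp
    qed
    ultimately show "\<exists>W. openin T W \<and> x \<in> W \<and> W \<subseteq> {x \<in> topspace T. f x \<in> U}" by blast
  qed
  then show ?thesis using fc sp by (auto simp: continuous_map_def)
qed

section \<open>Group topologies from a filter base at the identity\<close>

text \<open>The classical description of a group topology by its neighbourhood filter at the
  identity. The members of \<open>\<N>\<close> need not be open in the result; what has to be shown
  is that each of them has the identity in its interior.\<close>

lemma group_topology_from_filter_base:
  assumes H: "group H" and ne: "\<N> \<noteq> {}"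
    and sub: "\<And>N. N \<in> \<N> \<Longrightarrow> N \<subseteq> carrier H"
    and one: "\<And>N. N \<in> \<N> \<Longrightarrow> \<one>\<^bsub>H\<^esub> \<in> N"
    and int: "\<And>M N. M \<in> \<N> \<Longrightarrow> N \<in> \<N> \<Longrightarrow> \<exists>L\<in>\<N>. L \<subseteq> M \<inter> N"
    and mult: "\<And>N. N \<in> \<N> \<Longrightarrow> \<exists>M\<in>\<N>. \<forall>x\<in>M. \<forall>y\<in>M. x \<otimes>\<^bsub>H\<^esub> y \<in> N"
    and inv: "\<And>N. N \<in> \<N> \<Longrightarrow> \<exists>M\<in>\<N>. \<forall>x\<in>M. inv\<^bsub>H\<^esub> x \<in> N"
    and conj: "\<And>N g. N \<in> \<N> \<Longrightarrow> g \<in> carrier H \<Longrightarrow>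
                 \<exists>M\<in>\<N>. \<forall>x\<in>M. g \<otimes>\<^bsub>H\<^esub> x \<otimes>\<^bsub>H\<^esub> inv\<^bsub>H\<^esub> g \<in> N"
  shows "\<exists>S. topological_group H S \<and>
           (\<forall>N. nbhd_of S \<one>\<^bsub>H\<^esub> N \<longleftrightarrow> N \<subseteq> carrier H \<and> (\<exists>M\<in>\<N>. M \<subseteq> N))"
proof -
  interpret group H by (rule H)
  \<comment> \<open>A set is declared open when it contains, with each of its points, a left
    translate of some base member to that point.\<close>
  define op where "op V \<longleftrightarrow> V \<subseteq> carrier H \<and> (\<forall>x\<in>V. \<exists>N\<in>\<N>. \<forall>y\<in>N. x \<otimes>\<^bsub>H\<^esub> y \<in> V)" for V
  have "istopology op"
    unfolding istopology_def
  proof (intro conjI allI impI)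
    fix A B assume A: "op A" and B: "op B"
    have *: "\<exists>N\<in>\<N>. \<forall>y\<in>N. x \<otimes>\<^bsub>H\<^esub> y \<in> A \<inter> B" if "x \<in> A \<inter> B" for x
    proof -
      obtain M where M: "M \<in> \<N>" "\<forall>y\<in>M. x \<otimes>\<^bsub>H\<^esub> y \<in> A" using A \<open>x \<in> A \<inter> B\<close> by (force simp: op_def)
      obtain N where N: "N \<in> \<N>" "\<forall>y\<in>N. x \<otimes>\<^bsub>H\<^esub> y \<in> B" using B \<open>x \<in> A \<inter> B\<close> by (force simp: op_def)
      show ?thesis using int[OF M(1) N(1)] M(2) N(2) by blast
    qed
    show "op (A \<inter> B)"
      unfolding op_def
    proof (intro conjI ballI)
      show "A \<inter> B \<subseteq> carrier H" using A by (auto simp: op_def)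
    qed (rule *)
  next
    fix \<K> assume "\<forall>K\<in>\<K>. op K"
    then have K: "K \<subseteq> carrier H" "x \<in> K \<Longrightarrow> \<exists>N\<in>\<N>. \<forall>y\<in>N. x \<otimes>\<^bsub>H\<^esub> y \<in> K" if "K \<in> \<K>" for K x
      using that by (auto simp: op_def)
    show "op (\<Union>\<K>)"
      unfolding op_def
    proof (intro conjI ballI)
      show "\<Union>\<K> \<subseteq> carrier H" using K(1) by blast
      fix x assume "x \<in> \<Union>\<K>"
      then obtain K N where "K \<in> \<K>" "N \<in> \<N>" "\<forall>y\<in>N. x \<otimes>\<^bsub>H\<^esub> y \<in> K" using K(2) by blast
      then show "\<exists>N\<in>\<N>. \<forall>y\<in>N. x \<otimes>\<^bsub>H\<^esub> y \<in> \<Union>\<K>" by blast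
    qed
  qed
  define S where "S = topology op"
  have S: "openin S = op" unfolding S_def using \<open>istopology op\<close> by (rule topology_inverse')
  have sp: "topspace S = carrier H"
  proof -
    obtain N where "N \<in> \<N>" using ne by blast
    then have "op (carrier H)" using sub[of N] unfolding op_def by blast
    then show ?thesis unfolding topspace_def S by (auto simp: op_def)
  qed
  have nb: "\<exists>V. openin S V \<and> x \<in> V \<and> (\<forall>y\<in>V. \<exists>z\<in>N. y = x \<otimes>\<^bsub>H\<^esub> z)"
    if N: "N \<in> \<N>" and x: "x \<in> carrier H" for x N
  proof -
    \<comment> \<open>The interior of the translate of \<open>N\<close> by \<open>x\<close>: those
      \<open>y\<close> for which some whole translate \<open>y * M\<close> stays inside it, the
      condition being moved back to \<open>N\<close> by \<open>inv x\<close>.\<close>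
    let ?V = "{y \<in> carrier H. \<exists>M\<in>\<N>. \<forall>z\<in>M. inv\<^bsub>H\<^esub> x \<otimes>\<^bsub>H\<^esub> (y \<otimes>\<^bsub>H\<^esub> z) \<in> N}"
    have "\<exists>L\<in>\<N>. \<forall>z\<in>L. y \<otimes>\<^bsub>H\<^esub> z \<in> ?V" if y: "y \<in> ?V" for y
    proof -
      obtain M where M: "M \<in> \<N>" "\<forall>z\<in>M. inv\<^bsub>H\<^esub> x \<otimes>\<^bsub>H\<^esub> (y \<otimes>\<^bsub>H\<^esub> z) \<in> N" using y by blast
      \<comment> \<open>Since \<open>L * L\<close> lies in \<open>M\<close>, every
        \<open>y * z\<close> with \<open>z\<close> in \<open>L\<close> again has a whole translate
        (by \<open>L\<close>) inside, so \<open>?V\<close> is open.\<close>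
      obtain L where L: "L \<in> \<N>" "\<forall>z\<in>L. \<forall>w\<in>L. z \<otimes>\<^bsub>H\<^esub> w \<in> M" using mult[OF M(1)] by blast
      have "inv\<^bsub>H\<^esub> x \<otimes>\<^bsub>H\<^esub> ((y \<otimes>\<^bsub>H\<^esub> z) \<otimes>\<^bsub>H\<^esub> w) \<in> N" if "z \<in> L" "w \<in> L" for z w
      proof -
        have "z \<in> carrier H" "w \<in> carrier H" "y \<in> carrier H" using that sub[OF L(1)] y by auto
        then show ?thesis using that L M by (simp add: m_assoc)
      qed
      then show ?thesis using L(1) sub[OF L(1)] y by blast
    qed
    then have "openin S ?V" unfolding S op_def by blast
    moreover have "x \<in> ?V"
    proof -
      have "\<forall>z\<in>N. inv\<^bsub>H\<^esub> x \<otimes>\<^bsub>H\<^esub> (x \<otimes>\<^bsub>H\<^esub> z) \<in> N" using x sub[OF N] by (auto simp: m_assoc[symmetric])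
      then show ?thesis using x N by auto
    qed
    moreover have "\<exists>z\<in>N. y = x \<otimes>\<^bsub>H\<^esub> z" if y: "y \<in> ?V" for y
    proof
      have yc: "y \<in> carrier H" using y by blast
      obtain M where M: "M \<in> \<N>" "\<forall>z\<in>M. inv\<^bsub>H\<^esub> x \<otimes>\<^bsub>H\<^esub> (y \<otimes>\<^bsub>H\<^esub> z) \<in> N" using y by blast
      then have "inv\<^bsub>H\<^esub> x \<otimes>\<^bsub>H\<^esub> (y \<otimes>\<^bsub>H\<^esub> \<one>\<^bsub>H\<^esub>) \<in> N" using one by blast
      then show "inv\<^bsub>H\<^esub> x \<otimes>\<^bsub>H\<^esub> y \<in> N" using yc by simp
      show "y = x \<otimes>\<^bsub>H\<^esub> (inv\<^bsub>H\<^esub> x \<otimes>\<^bsub>H\<^esub> y)" using x yc by (simp add: m_assoc[symmetric])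
    qed
    ultimately show ?thesis by blast
  qed
  have "continuous_map (prod_topology S S) S (\<lambda>(x, y). x \<otimes>\<^bsub>H\<^esub> y)"
  proof -
    have "openin (prod_topology S S) {p \<in> topspace (prod_topology S S). (case p of (x, y) \<Rightarrow> x \<otimes>\<^bsub>H\<^esub> y) \<in> U}"
      if U: "openin S U" for U
      unfolding openin_prod_topology_alt
    proof (intro allI impI)
      fix x y assume "(x, y) \<in> {p \<in> topspace (prod_topology S S). (case p of (x, y) \<Rightarrow> x \<otimes>\<^bsub>H\<^esub> y) \<in> U}"
      then have xy: "x \<in> carrier H" "y \<in> carrier H" "x \<otimes>\<^bsub>H\<^esub> y \<in> U" using sp by auto
      then obtain N where N: "N \<in> \<N>" "\<forall>z\<in>N. x \<otimes>\<^bsub>H\<^esub> y \<otimes>\<^bsub>H\<^esub> z \<in> U" using U by (auto simp: S op_def)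
      obtain M where M: "M \<in> \<N>" "\<forall>z\<in>M. \<forall>w\<in>M. z \<otimes>\<^bsub>H\<^esub> w \<in> N" using mult[OF N(1)] by blast
      \<comment> \<open>In \<open>x * z * (y * w)\<close> the factor \<open>z\<close> has to pass
        \<open>y\<close>, which turns it into its conjugate \<open>inv y * z * y\<close>;
        \<open>L\<close> is chosen so small that this conjugate still lies in
        \<open>M\<close>.\<close>
      obtain L where L: "L \<in> \<N>" "\<forall>z\<in>L. inv\<^bsub>H\<^esub> y \<otimes>\<^bsub>H\<^esub> z \<otimes>\<^bsub>H\<^esub> y \<in> M"
        using conj[OF M(1) inv_closed[OF xy(2)]] unfolding inv_inv[OF xy(2)] by blast
      obtain A where A: "openin S A" "x \<in> A" "\<forall>a\<in>A. \<exists>z\<in>L. a = x \<otimes>\<^bsub>H\<^esub> z"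
        using nb[OF L(1) xy(1)] by (elim exE conjE) (rule that)
      obtain B where B: "openin S B" "y \<in> B" "\<forall>b\<in>B. \<exists>z\<in>M. b = y \<otimes>\<^bsub>H\<^esub> z"
        using nb[OF M(1) xy(2)] by (elim exE conjE) (rule that)
      have AB: "a \<otimes>\<^bsub>H\<^esub> b \<in> U" if ab: "a \<in> A" "b \<in> B" for a b
      proof -
        obtain z w where zw: "z \<in> L" "a = x \<otimes>\<^bsub>H\<^esub> z" "w \<in> M" "b = y \<otimes>\<^bsub>H\<^esub> w"
          using bspec[OF A(3) ab(1)] bspec[OF B(3) ab(2)] by (elim bexE) (rule that)
        then have c: "z \<in> carrier H" "w \<in> carrier H" using sub L M by auto
        have "a \<otimes>\<^bsub>H\<^esub> b = x \<otimes>\<^bsub>H\<^esub> y \<otimes>\<^bsub>H\<^esub> ((inv\<^bsub>H\<^esub> y \<otimes>\<^bsub>H\<^esub> z \<otimes>\<^bsub>H\<^esub> y) \<otimes>\<^bsub>H\<^esub> w)"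
        proof -
          have "y \<otimes>\<^bsub>H\<^esub> (inv\<^bsub>H\<^esub> y \<otimes>\<^bsub>H\<^esub> (z \<otimes>\<^bsub>H\<^esub> (y \<otimes>\<^bsub>H\<^esub> w))) = z \<otimes>\<^bsub>H\<^esub> (y \<otimes>\<^bsub>H\<^esub> w)"
            using xy c by (simp add: m_assoc[symmetric])
          then show ?thesis using xy c zw by (simp add: m_assoc)
        qed
        then show ?thesis using zw L M N by simp
      qed
      have "A \<times> B \<subseteq> {p \<in> topspace (prod_topology S S). (case p of (x, y) \<Rightarrow> x \<otimes>\<^bsub>H\<^esub> y) \<in> U}"
        using AB openin_subset[OF A(1)] openin_subset[OF B(1)] by auto
      then show "\<exists>A B. openin S A \<and> openin S B \<and> x \<in> A \<and> y \<in> B \<and>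
          A \<times> B \<subseteq> {p \<in> topspace (prod_topology S S). (case p of (x, y) \<Rightarrow> x \<otimes>\<^bsub>H\<^esub> y) \<in> U}"
        using A(1,2) B(1,2) by blast
    qed
    then show ?thesis by (auto simp: continuous_map_def sp)
  qed
  moreover have "continuous_map S S (\<lambda>x. inv\<^bsub>H\<^esub> x)"
  proof -
    have "openin S {x \<in> topspace S. inv\<^bsub>H\<^esub> x \<in> U}" if U: "openin S U" for U
      unfolding S op_def
    proof (intro conjI ballI)
      fix x assume "x \<in> {x \<in> topspace S. inv\<^bsub>H\<^esub> x \<in> U}"
      then have x: "x \<in> carrier H" "inv\<^bsub>H\<^esub> x \<in> U" using sp by auto
      then obtain N where N: "N \<in> \<N>" "\<forall>z\<in>N. inv\<^bsub>H\<^esub> x \<otimes>\<^bsub>H\<^esub> z \<in> U" using U by (auto simp: S op_def)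
      \<comment> \<open>The inverse of \<open>x * z\<close> is \<open>inv x\<close> times the
        conjugate of \<open>inv z\<close> by \<open>x\<close>, so both the conjugation and the
        inversion axiom are used.\<close>
      obtain M where M: "M \<in> \<N>" "\<forall>z\<in>M. x \<otimes>\<^bsub>H\<^esub> z \<otimes>\<^bsub>H\<^esub> inv\<^bsub>H\<^esub> x \<in> N"
        using conj[OF N(1) x(1)] by blast
      obtain L where L: "L \<in> \<N>" "\<forall>z\<in>L. inv\<^bsub>H\<^esub> z \<in> M" using inv[OF M(1)] by blast
      have "x \<otimes>\<^bsub>H\<^esub> z \<in> {x \<in> topspace S. inv\<^bsub>H\<^esub> x \<in> U}" if z: "z \<in> L" for z
      proof -
        have zc: "z \<in> carrier H" using z sub L by auto
        have "inv\<^bsub>H\<^esub> (x \<otimes>\<^bsub>H\<^esub> z) = inv\<^bsub>H\<^esub> x \<otimes>\<^bsub>H\<^esub> (x \<otimes>\<^bsub>H\<^esub> inv\<^bsub>H\<^esub> z \<otimes>\<^bsub>H\<^esub> inv\<^bsub>H\<^esub> x)"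
          using x zc by (simp add: inv_mult_group m_assoc[symmetric])
        then show ?thesis using z L M N x zc sp by simp
      qed
      then show "\<exists>N\<in>\<N>. \<forall>y\<in>N. x \<otimes>\<^bsub>H\<^esub> y \<in> {x \<in> topspace S. inv\<^bsub>H\<^esub> x \<in> U}" using L by blast
    qed (use sp in auto)
    then show ?thesis by (auto simp: continuous_map_def sp)
  qed
  moreover have "nbhd_of S \<one>\<^bsub>H\<^esub> N \<longleftrightarrow> N \<subseteq> carrier H \<and> (\<exists>M\<in>\<N>. M \<subseteq> N)" for N
  proof
    assume "nbhd_of S \<one>\<^bsub>H\<^esub> N"
    then obtain V M where "N \<subseteq> carrier H" "V \<subseteq> N" "op V" "M \<in> \<N>" "\<forall>y\<in>M. \<one>\<^bsub>H\<^esub> \<otimes>\<^bsub>H\<^esub> y \<in> V"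
      unfolding nbhd_of_def S sp op_def by blast
    moreover then have "M \<subseteq> V" using sub[of M] by (metis l_one subset_iff)
    ultimately show "N \<subseteq> carrier H \<and> (\<exists>M\<in>\<N>. M \<subseteq> N)" by blast
  next
    assume "N \<subseteq> carrier H \<and> (\<exists>M\<in>\<N>. M \<subseteq> N)"
    then obtain M where M: "N \<subseteq> carrier H" "M \<in> \<N>" "M \<subseteq> N" by blast
    \<comment> \<open>The interior constructed in \<open>nb\<close>, taken at the identity, lies in
      \<open>M\<close> and shows that \<open>M\<close> is a neighbourhood.\<close>
    obtain V where V: "openin S V" "\<one>\<^bsub>H\<^esub> \<in> V" "\<forall>y\<in>V. \<exists>z\<in>M. y = \<one>\<^bsub>H\<^esub> \<otimes>\<^bsub>H\<^esub> z"
      using nb[OF M(2) one_closed] by blast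
    have "V \<subseteq> N" using V(3) sub[OF M(2)] M(3) by (metis l_one subset_iff)
    then show "nbhd_of S \<one>\<^bsub>H\<^esub> N" using V M sp by (intro nbhd_ofI) auto
  qed
  ultimately show ?thesis using H sp unfolding topological_group_def by blast
qed

section \<open>Products over distinct indices\<close>

definition list_prod :: "('a, 'b) monoid_scheme \<Rightarrow> 'a list \<Rightarrow> 'a" where
  "list_prod H ys = foldr (\<lambda>y z. y \<otimes>\<^bsub>H\<^esub> z) ys \<one>\<^bsub>H\<^esub>"

lemma list_prod_simps [simp]:
  "list_prod H [] = \<one>\<^bsub>H\<^esub>" "list_prod H (y # ys) = y \<otimes>\<^bsub>H\<^esub> list_prod H ys"
  by (simp_all add: list_prod_def)

text \<open>The union of all finite products \<open>S k1 * ... * S kn\<close> over injective index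
  sequences. The indices may come in any order, which makes the construction compatible with
  inversion; using each index at most once is what keeps the products small.\<close>

definition distinct_prods :: "('a, 'b) monoid_scheme \<Rightarrow> (nat \<Rightarrow> 'a set) \<Rightarrow> 'a set" where
  "distinct_prods H S =
     {list_prod H (map snd w) | w. distinct (map fst w) \<and> (\<forall>p\<in>set w. snd p \<in> S (fst p))}"

lemma distinct_prodsI:
  "distinct (map fst w) \<Longrightarrow> (\<And>k y. (k, y) \<in> set w \<Longrightarrow> y \<in> S k) \<Longrightarrow>
     list_prod H (map snd w) \<in> distinct_prods H S"
  unfolding distinct_prods_def by fastforce

lemma distinct_prodsD:
  "a \<in> distinct_prods H S \<Longrightarrow>
     \<exists>w. a = list_prod H (map snd w) \<and> distinct (map fst w) \<and> (\<forall>k y. (k, y) \<in> set w \<longrightarrow> y \<in> S k)"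
  unfolding distinct_prods_def by fastforce

lemma distinct_prods_mono: "(\<And>k. S k \<subseteq> S' k) \<Longrightarrow> distinct_prods H S \<subseteq> distinct_prods H S'"
  by (fastforce simp: distinct_prods_def)

lemma one_in_distinct_prods: "\<one>\<^bsub>H\<^esub> \<in> distinct_prods H S"
  using distinct_prodsI[of "[]" S H] by simp

context group
begin

lemma list_prod_closed [simp]: "set ys \<subseteq> carrier G \<Longrightarrow> list_prod G ys \<in> carrier G"
  by (induction ys) auto

lemma list_prod_append:
  "set xs \<subseteq> carrier G \<Longrightarrow> set ys \<subseteq> carrier G \<Longrightarrow>
     list_prod G (xs @ ys) = list_prod G xs \<otimes> list_prod G ys"
  by (induction xs) (auto simp: m_assoc)

lemma list_prod_inv:
  "set ys \<subseteq> carrier G \<Longrightarrow> inv (list_prod G ys) = list_prod G (rev (map (\<lambda>y. inv y) ys))"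
proof (induction ys)
  case (Cons y ys)
  moreover from this have "set (map (\<lambda>y. inv y) ys) \<subseteq> carrier G" by auto
  ultimately show ?case by (simp add: list_prod_append inv_mult_group)
qed simp

lemma list_prod_conj:
  assumes "g \<in> carrier G"
  shows "set ys \<subseteq> carrier G \<Longrightarrow>
     g \<otimes> list_prod G ys \<otimes> inv g = list_prod G (map (\<lambda>y. g \<otimes> y \<otimes> inv g) ys)"
proof (induction ys)
  case (Cons y ys)
  then have "list_prod G (map (\<lambda>y. g \<otimes> y \<otimes> inv g) (y # ys)) =
      (g \<otimes> y \<otimes> inv g) \<otimes> (g \<otimes> list_prod G ys \<otimes> inv g)" by simp
  also have "\<dots> = g \<otimes> y \<otimes> (inv g \<otimes> (g \<otimes> (list_prod G ys \<otimes> inv g)))"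
    using Cons.prems assms by (simp add: m_assoc)
  also have "inv g \<otimes> (g \<otimes> (list_prod G ys \<otimes> inv g)) = list_prod G ys \<otimes> inv g"
    using Cons.prems assms by (simp add: m_assoc[symmetric])
  finally show ?case using Cons assms by (simp add: m_assoc)
qed (use assms in simp)

context
  fixes S :: "nat \<Rightarrow> 'a set"
  assumes S: "\<And>k. S k \<subseteq> carrier G"
begin

private lemma word_closed: "(\<And>k y. (k, y) \<in> set w \<Longrightarrow> y \<in> S k) \<Longrightarrow> set (map snd w) \<subseteq> carrier G"
  using S by fastforce

lemma distinct_prods_closed: "distinct_prods G S \<subseteq> carrier G"
proof
  fix a assume "a \<in> distinct_prods G S"
  then obtain w where "a = list_prod G (map snd w)" and w: "\<And>k y. (k, y) \<in> set w \<Longrightarrow> y \<in> S k"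
    using distinct_prodsD by metis
  then show "a \<in> carrier G" using word_closed[OF w] by simp
qed

lemma subset_distinct_prods: "S k \<subseteq> distinct_prods G S"
proof
  fix y assume "y \<in> S k"
  then show "y \<in> distinct_prods G S"
    using distinct_prodsI[of "[(k, y)]" S G] subsetD[OF S] by simp
qed

text \<open>Inversion reverses a word, and a reversed word still has distinct indices.\<close>

lemma distinct_prods_inv:
  assumes S': "\<And>k y. y \<in> S k \<Longrightarrow> inv y \<in> S' k" and a: "a \<in> distinct_prods G S"
  shows "inv a \<in> distinct_prods G S'"
proof -
  obtain w where w: "a = list_prod G (map snd w)" "distinct (map fst w)"
    "\<And>k y. (k, y) \<in> set w \<Longrightarrow> y \<in> S k" using distinct_prodsD[OF a] by metis
  let ?w = "rev (map (\<lambda>(k, y). (k, inv y)) w)"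
  have "inv a = list_prod G (map snd ?w)"
    using list_prod_inv[OF word_closed[OF w(3)]] by (simp add: w(1) rev_map o_def split_def)
  moreover have "list_prod G (map snd ?w) \<in> distinct_prods G S'"
    using w S' by (intro distinct_prodsI) (auto simp: rev_map[symmetric] o_def split_def)
  ultimately show ?thesis by simp
qed

lemma distinct_prods_conj:
  assumes g: "g \<in> carrier G" and S': "\<And>k y. y \<in> S k \<Longrightarrow> g \<otimes> y \<otimes> inv g \<in> S' k"
    and a: "a \<in> distinct_prods G S"
  shows "g \<otimes> a \<otimes> inv g \<in> distinct_prods G S'"
proof -
  obtain w where w: "a = list_prod G (map snd w)" "distinct (map fst w)"
    "\<And>k y. (k, y) \<in> set w \<Longrightarrow> y \<in> S k" using distinct_prodsD[OF a] by metis
  let ?w = "map (\<lambda>(k, y). (k, g \<otimes> y \<otimes> inv g)) w"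
  have "g \<otimes> a \<otimes> inv g = list_prod G (map snd ?w)"
    using list_prod_conj[OF g word_closed[OF w(3)]] by (simp add: w(1) o_def split_def)
  moreover have "list_prod G (map snd ?w) \<in> distinct_prods G S'"
    using w S' by (intro distinct_prodsI) (auto simp: o_def split_def)
  ultimately show ?thesis by simp
qed

text \<open>The indices of the two words may overlap. Sending those of the first to even numbers and
  those of the second to odd numbers makes the concatenation distinct.\<close>

lemma distinct_prods_mult:
  assumes S': "\<And>k y. y \<in> S k \<Longrightarrow> y \<in> S' (2 * k) \<and> y \<in> S' (2 * k + 1)"
    and a: "a \<in> distinct_prods G S" and b: "b \<in> distinct_prods G S"
  shows "a \<otimes> b \<in> distinct_prods G S'"
proof -
  obtain v where v: "a = list_prod G (map snd v)" "distinct (map fst v)"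
    "\<And>k y. (k, y) \<in> set v \<Longrightarrow> y \<in> S k" using distinct_prodsD[OF a] by metis
  obtain w where w: "b = list_prod G (map snd w)" "distinct (map fst w)"
    "\<And>k y. (k, y) \<in> set w \<Longrightarrow> y \<in> S k" using distinct_prodsD[OF b] by metis
  let ?u = "map (\<lambda>(k, y). (2 * k, y)) v @ map (\<lambda>(k, y). (2 * k + 1, y)) w"
  have "a \<otimes> b = list_prod G (map snd ?u)"
    using list_prod_append[OF word_closed[OF v(3)] word_closed[OF w(3)]]
    by (simp add: v(1) w(1) o_def split_def)
  moreover have "distinct (map fst ?u)"
  proof -
    have "map fst ?u = map (\<lambda>k. 2 * k) (map fst v) @ map (\<lambda>k. 2 * k + 1) (map fst w)"
      by (simp add: o_def split_def)
    moreover have "distinct (map (\<lambda>k::nat. 2 * k) (map fst v))"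
      using v(2) by (subst distinct_map) (simp add: inj_on_def)
    moreover have "distinct (map (\<lambda>k::nat. 2 * k + 1) (map fst w))"
      using w(2) by (subst distinct_map) (simp add: inj_on_def)
    moreover have "(\<lambda>k::nat. 2 * k) ` A \<inter> (\<lambda>k. 2 * k + 1) ` B = {}" for A B
      by auto presburger
    ultimately show ?thesis by (simp only: distinct_append set_map)
  qed
  then have "list_prod G (map snd ?u) \<in> distinct_prods G S'"
    using v w S' by (intro distinct_prodsI) auto
  ultimately show ?thesis by simp
qed

text \<open>Splitting a word at its least index \<open>k\<close> writes its product as one of three elements of \<open>W (Suc k)\<close>.\<close>

lemma distinct_prods_subset:
  assumes SW: "\<And>k. S k \<subseteq> W (Suc k)" and one: "\<And>k. \<one> \<in> W k"
    and W3: "\<And>k x y z. x \<in> W (Suc k) \<Longrightarrow> y \<in> W (Suc k) \<Longrightarrow> z \<in> W (Suc k) \<Longrightarrow> x \<otimes> (y \<otimes> z) \<in> W k"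
    and W: "\<And>k. W k \<subseteq> carrier G"
  shows "distinct_prods G S \<subseteq> W 0"
proof -
  \<comment> \<open>An element \<open>x\<close> equals \<open>x * (1 * 1)\<close>, so the cube
    condition already makes \<open>W\<close> decreasing.\<close>
  have "W (Suc k) \<subseteq> W k" for k
    using W3[OF _ one one] W by (metis one_closed r_one subset_iff)
  then have dec: "W n \<subseteq> W m" if "m \<le> n" for m n
    using that by (rule lift_Suc_antimono_le)
  \<comment> \<open>The claim is generalised to words whose indices are all at least
    \<open>m\<close>. The induction is on length because both pieces around the least letter are
    shorter, and \<open>m\<close> varies because the pieces are used with the bound
    \<open>Suc k\<close>.\<close>
  have "list_prod G (map snd w) \<in> W m"
    if "distinct (map fst w)" "\<And>k y. (k, y) \<in> set w \<Longrightarrow> y \<in> S k \<and> m \<le> k" for w m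
    using that
  proof (induction w arbitrary: m rule: length_induct)
    case (1 w)
    show ?case
    proof (cases "w = []")
      case False
      define k where "k = Min (fst ` set w)"
      have "k \<in> fst ` set w" unfolding k_def using False by (intro Min_in) auto
      then obtain y where ky: "(k, y) \<in> set w" by auto
      then obtain u v where w: "w = u @ (k, y) # v" by (meson split_list)
      have min: "k \<le> k'" if "(k', y') \<in> set w" for k' y'
        unfolding k_def using that by (intro Min_le) force+
      \<comment> \<open>Distinctness of the indices makes the minimum strict on both pieces.\<close>
      have gt: "y' \<in> S k' \<and> Suc k \<le> k'" if "(k', y') \<in> set u \<union> set v" for k' y'
      proof -
        have "k' \<noteq> k" using 1(2) that unfolding w by force
        then show ?thesis using min[of k' y'] 1(3)[of k' y'] that unfolding w by force
      qed
      have "list_prod G (map snd u) \<in> W (Suc k)" "list_prod G (map snd v) \<in> W (Suc k)"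
        using 1(1)[rule_format, of u "Suc k"] 1(1)[rule_format, of v "Suc k"] 1(2) gt
        unfolding w by auto
      moreover have "y \<in> W (Suc k)" using 1(3)[OF ky] SW by auto
      ultimately have "list_prod G (map snd u) \<otimes> (y \<otimes> list_prod G (map snd v)) \<in> W k"
        using W3 by blast
      moreover have "set (map snd u) \<subseteq> carrier G" "set (map snd (((k, y) # v))) \<subseteq> carrier G"
        using word_closed[of u] word_closed[of "(k, y) # v"] 1(3) unfolding w by auto
      then have "list_prod G (map snd w) = list_prod G (map snd u) \<otimes> (y \<otimes> list_prod G (map snd v))"
        by (simp add: w list_prod_append)
      ultimately show ?thesis using dec[of m k] 1(3)[OF ky] by auto
    qed (simp add: one)
  qed
  then show ?thesis using distinct_prodsD[of _ G S] by (metis le0 subsetI)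
qed

end

end

section \<open>Products of conjugates of neighbourhoods in the factors\<close>

context
  fixes H :: "('h, 'c) monoid_scheme" and I :: "'i set" and D :: "'h set"
    and G :: "'i \<Rightarrow> ('a, 'b) monoid_scheme" and T :: "'i \<Rightarrow> 'a topology" and f :: "'i \<Rightarrow> 'a \<Rightarrow> 'h"
begin

text \<open>The neighbourhood is allowed to depend on the conjugator \<open>d\<close>, since
  conjugations by infinitely many elements need not be equicontinuous at the identity.\<close>

definition conj_union :: "('i \<Rightarrow> 'h \<Rightarrow> 'a set) \<Rightarrow> 'h set" where
  "conj_union V = (\<Union>i\<in>I. \<Union>d\<in>D. (\<lambda>x. d \<otimes>\<^bsub>H\<^esub> f i x \<otimes>\<^bsub>H\<^esub> inv\<^bsub>H\<^esub> d) ` V i d)"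

definition conj_prods :: "(nat \<Rightarrow> 'i \<Rightarrow> 'h \<Rightarrow> 'a set) \<Rightarrow> 'h set" where
  "conj_prods V = distinct_prods H (\<lambda>k. conj_union (V k))"

definition nbhd_family :: "(nat \<Rightarrow> 'i \<Rightarrow> 'h \<Rightarrow> 'a set) \<Rightarrow> bool" where
  "nbhd_family V \<longleftrightarrow> (\<forall>k. \<forall>i\<in>I. \<forall>d\<in>D. nbhd_of (T i) \<one>\<^bsub>G i\<^esub> (V k i d))"

lemma conj_unionI:
  "i \<in> I \<Longrightarrow> d \<in> D \<Longrightarrow> x \<in> V i d \<Longrightarrow> d \<otimes>\<^bsub>H\<^esub> f i x \<otimes>\<^bsub>H\<^esub> inv\<^bsub>H\<^esub> d \<in> conj_union V"
  by (auto simp: conj_union_def)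

lemma conj_unionE:
  assumes "y \<in> conj_union V"
  obtains i d x where "i \<in> I" "d \<in> D" "x \<in> V i d" "y = d \<otimes>\<^bsub>H\<^esub> f i x \<otimes>\<^bsub>H\<^esub> inv\<^bsub>H\<^esub> d"
  using assms by (auto simp: conj_union_def)

lemma conj_prods_mono:
  assumes "\<And>k i d. i \<in> I \<Longrightarrow> d \<in> D \<Longrightarrow> V k i d \<subseteq> V' k i d"
  shows "conj_prods V \<subseteq> conj_prods V'"
  unfolding conj_prods_def
proof (rule distinct_prods_mono)
  show "conj_union (V k) \<subseteq> conj_union (V' k)" for k
    using assms by (fastforce simp: conj_union_def)
qed

context
  assumes H: "group H"
    and top: "\<And>i. i \<in> I \<Longrightarrow> topological_group (G i) (T i)"
    and f: "\<And>i. i \<in> I \<Longrightarrow> f i \<in> hom (G i) H"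
    and D: "D \<subseteq> carrier H"
begin

interpretation H: group H by (rule H)

private lemma f_closed: "i \<in> I \<Longrightarrow> x \<in> carrier (G i) \<Longrightarrow> f i x \<in> carrier H"
  using f by (auto simp: hom_def)

private lemma family_closed: "nbhd_family V \<Longrightarrow> i \<in> I \<Longrightarrow> d \<in> D \<Longrightarrow> x \<in> V k i d \<Longrightarrow> x \<in> carrier (G i)"
  using top nbhd_ofD(2) by (fastforce simp: nbhd_family_def topological_group_def)

lemma conj_union_closed:
  assumes V: "nbhd_family V" shows "conj_union (V k) \<subseteq> carrier H"
proof
  fix y assume "y \<in> conj_union (V k)"
  then show "y \<in> carrier H"
  proof (rule conj_unionE)
    fix i d x assume *: "i \<in> I" "d \<in> D" "x \<in> V k i d" "y = d \<otimes>\<^bsub>H\<^esub> f i x \<otimes>\<^bsub>H\<^esub> inv\<^bsub>H\<^esub> d"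
    then show "y \<in> carrier H" using f_closed family_closed[OF V] D by auto
  qed
qed

lemma conj_prods_closed: "nbhd_family V \<Longrightarrow> conj_prods V \<subseteq> carrier H"
  unfolding conj_prods_def using conj_union_closed by (rule H.distinct_prods_closed)

lemma one_in_conj_prods: "\<one>\<^bsub>H\<^esub> \<in> conj_prods V"
  unfolding conj_prods_def by (rule one_in_distinct_prods)

lemma conj_prods_mult:
  assumes V: "nbhd_family V"
  shows "\<exists>V'. nbhd_family V' \<and> (\<forall>x\<in>conj_prods V'. \<forall>y\<in>conj_prods V'. x \<otimes>\<^bsub>H\<^esub> y \<in> conj_prods V)"
proof -
  \<comment> \<open>A letter of index \<open>k\<close> must be admissible at both
    \<open>2 * k\<close> and \<open>2 * k + 1\<close>, the places to which the two factors of a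
    product move it.\<close>
  let ?V = "\<lambda>k i d. V (2 * k) i d \<inter> V (2 * k + 1) i d"
  have V': "nbhd_family ?V" using V by (auto simp: nbhd_family_def intro: nbhd_of_Int)
  have step: "y \<in> conj_union (V (2 * k)) \<and> y \<in> conj_union (V (2 * k + 1))" if "y \<in> conj_union (?V k)" for k y
    using that by (auto simp: conj_union_def)
  have "\<forall>x\<in>conj_prods ?V. \<forall>y\<in>conj_prods ?V. x \<otimes>\<^bsub>H\<^esub> y \<in> conj_prods V"
    unfolding conj_prods_def
    by (intro ballI H.distinct_prods_mult[where S = "\<lambda>k. conj_union (?V k)" and S' = "\<lambda>k. conj_union (V k)"]
        conj_union_closed[OF V'] step)
  with V' show ?thesis by blast
qed

text \<open>The inverse of \<open>d * f i x * inv d\<close> is the conjugate of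
  \<open>f i (inv x)\<close> by the same \<open>d\<close>, so shrinking each neighbourhood by
  inversion is enough.\<close>

lemma conj_prods_inv:
  assumes V: "nbhd_family V"
  shows "\<exists>V'. nbhd_family V' \<and> (\<forall>x\<in>conj_prods V'. inv\<^bsub>H\<^esub> x \<in> conj_prods V)"
proof -
  let ?V = "\<lambda>k i d. {x \<in> carrier (G i). inv\<^bsub>G i\<^esub> x \<in> V k i d}"
  have V': "nbhd_family ?V"
    using V top by (auto simp: nbhd_family_def intro: topological_group_inv_nbhd)
  have step: "inv\<^bsub>H\<^esub> y \<in> conj_union (V k)" if "y \<in> conj_union (?V k)" for k y
    using that
  proof (rule conj_unionE)
    fix i d x assume *: "i \<in> I" "d \<in> D" "x \<in> ?V k i d" "y = d \<otimes>\<^bsub>H\<^esub> f i x \<otimes>\<^bsub>H\<^esub> inv\<^bsub>H\<^esub> d"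
    interpret h: group_hom "G i" H "f i"
      using top[OF *(1)] f[OF *(1)] H by (simp add: topological_group_def group_hom_def group_hom_axioms_def)
    have "d \<in> carrier H" using * D by auto
    then have "inv\<^bsub>H\<^esub> y = d \<otimes>\<^bsub>H\<^esub> f i (inv\<^bsub>G i\<^esub> x) \<otimes>\<^bsub>H\<^esub> inv\<^bsub>H\<^esub> d"
      using * by (simp add: H.inv_mult_group H.m_assoc)
    then show "inv\<^bsub>H\<^esub> y \<in> conj_union (V k)" using * conj_unionI[of i d "inv\<^bsub>G i\<^esub> x" "V k"] by simp
  qed
  have "\<forall>x\<in>conj_prods ?V. inv\<^bsub>H\<^esub> x \<in> conj_prods V"
    unfolding conj_prods_def
    by (intro ballI H.distinct_prods_inv[where S = "\<lambda>k. conj_union (?V k)" and S' = "\<lambda>k. conj_union (V k)"]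
        conj_union_closed[OF V'] step)
  with V' show ?thesis by blast
qed

text \<open>Conjugating by \<open>d\<close> replaces a conjugator \<open>d'\<close> by
  \<open>d * d'\<close>, so the family is merely reindexed. This is the reason for taking
  \<open>D\<close> closed under multiplication.\<close>

lemma conj_prods_conj_submonoid:
  assumes V: "nbhd_family V" and d: "d \<in> D" and DD: "\<And>d'. d' \<in> D \<Longrightarrow> d \<otimes>\<^bsub>H\<^esub> d' \<in> D"
  shows "\<exists>V'. nbhd_family V' \<and> (\<forall>x\<in>conj_prods V'. d \<otimes>\<^bsub>H\<^esub> x \<otimes>\<^bsub>H\<^esub> inv\<^bsub>H\<^esub> d \<in> conj_prods V)"
proof -
  let ?V = "\<lambda>k i d'. V k i (d \<otimes>\<^bsub>H\<^esub> d')"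
  have V': "nbhd_family ?V" using V DD by (auto simp: nbhd_family_def)
  have dc: "d \<in> carrier H" using d D by auto
  have step: "d \<otimes>\<^bsub>H\<^esub> y \<otimes>\<^bsub>H\<^esub> inv\<^bsub>H\<^esub> d \<in> conj_union (V k)" if "y \<in> conj_union (?V k)" for k y
    using that
  proof (rule conj_unionE)
    fix i d' x assume *: "i \<in> I" "d' \<in> D" "x \<in> ?V k i d'" "y = d' \<otimes>\<^bsub>H\<^esub> f i x \<otimes>\<^bsub>H\<^esub> inv\<^bsub>H\<^esub> d'"
    have c: "d' \<in> carrier H" "f i x \<in> carrier H"
      using * D f_closed family_closed[OF V' *(1-3)] by auto
    have "d \<otimes>\<^bsub>H\<^esub> y \<otimes>\<^bsub>H\<^esub> inv\<^bsub>H\<^esub> d = (d \<otimes>\<^bsub>H\<^esub> d') \<otimes>\<^bsub>H\<^esub> f i x \<otimes>\<^bsub>H\<^esub> inv\<^bsub>H\<^esub> (d \<otimes>\<^bsub>H\<^esub> d')"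
      using * c dc by (simp add: H.inv_mult_group H.m_assoc)
    then show ?thesis using * DD conj_unionI[of i "d \<otimes>\<^bsub>H\<^esub> d'" x "V k"] by simp
  qed
  have "\<forall>x\<in>conj_prods ?V. d \<otimes>\<^bsub>H\<^esub> x \<otimes>\<^bsub>H\<^esub> inv\<^bsub>H\<^esub> d \<in> conj_prods V"
    unfolding conj_prods_def
    by (intro ballI H.distinct_prods_conj[where S = "\<lambda>k. conj_union (?V k)" and S' = "\<lambda>k. conj_union (V k)"]
        conj_union_closed[OF V'] step dc)
  with V' show ?thesis by blast
qed

lemma conj_prods_subset_nbhd:
  assumes S: "topological_group H S" and cont: "\<And>i. i \<in> I \<Longrightarrow> continuous_map (T i) S (f i)"
    and N: "nbhd_of S \<one>\<^bsub>H\<^esub> N"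
  shows "\<exists>V. nbhd_family V \<and> conj_prods V \<subseteq> N"
proof -
  \<comment> \<open>Dependent choice of a sequence with cubes decreasing; the clause for
    \<open>k = 0\<close> pins its first term to \<open>N\<close>.\<close>
  have "\<exists>W. \<forall>k. (nbhd_of S \<one>\<^bsub>H\<^esub> (W k) \<and> (k = 0 \<longrightarrow> W k = N)) \<and>
      (\<forall>x\<in>W (Suc k). \<forall>y\<in>W (Suc k). \<forall>z\<in>W (Suc k). x \<otimes>\<^bsub>H\<^esub> (y \<otimes>\<^bsub>H\<^esub> z) \<in> W k)"
    by (rule dependent_nat_choice) (use N topological_group_mult3_nbhd[OF S] in auto)
  then obtain W where W: "\<And>k. nbhd_of S \<one>\<^bsub>H\<^esub> (W k)" "W 0 = N"
    "\<And>k x y z. x \<in> W (Suc k) \<Longrightarrow> y \<in> W (Suc k) \<Longrightarrow> z \<in> W (Suc k) \<Longrightarrow> x \<otimes>\<^bsub>H\<^esub> (y \<otimes>\<^bsub>H\<^esub> z) \<in> W k"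
    by blast
  \<comment> \<open>The preimage of \<open>W (Suc k)\<close> under \<open>f i\<close> followed by
    conjugation by \<open>d\<close>. The shift to \<open>Suc k\<close> is the one required for
    splitting a word at its least index: a letter of index \<open>k\<close> and both pieces around
    it lie in \<open>W (Suc k)\<close>.\<close>
  define V where "V k i d = {x \<in> topspace (T i). f i x \<in>
      {y \<in> carrier H. d \<otimes>\<^bsub>H\<^esub> y \<otimes>\<^bsub>H\<^esub> inv\<^bsub>H\<^esub> d \<in> W (Suc k)}}" for k i d
  have "nbhd_of (T i) \<one>\<^bsub>G i\<^esub> (V k i d)" if i: "i \<in> I" "d \<in> D" for k i d
    unfolding V_def
  proof (rule nbhd_of_continuous_map[OF cont[OF i(1)]])
    have Gi: "group (G i)" "topspace (T i) = carrier (G i)"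
      using top[OF i(1)] by (auto simp: topological_group_def)
    then show "\<one>\<^bsub>G i\<^esub> \<in> topspace (T i)" by (simp add: group.is_monoid monoid.one_closed)
    have "f i \<one>\<^bsub>G i\<^esub> = \<one>\<^bsub>H\<^esub>" using hom_one[OF f Gi(1) H] i by blast
    then show "nbhd_of S (f i \<one>\<^bsub>G i\<^esub>) {y \<in> carrier H. d \<otimes>\<^bsub>H\<^esub> y \<otimes>\<^bsub>H\<^esub> inv\<^bsub>H\<^esub> d \<in> W (Suc k)}"
      using topological_group_conj_nbhd[OF S _ W(1)] D i by auto
  qed
  then have V: "nbhd_family V" by (simp add: nbhd_family_def)
  have "conj_union (V k) \<subseteq> W (Suc k)" for k by (auto simp: conj_union_def V_def)
  moreover have "W k \<subseteq> carrier H" for k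
    using nbhd_ofD(2)[OF W(1)] S by (auto simp: topological_group_def)
  ultimately have "conj_prods V \<subseteq> W 0"
    unfolding conj_prods_def using conj_union_closed[OF V] W nbhd_ofD(1)[OF W(1)]
    by (intro H.distinct_prods_subset)
  with V W show ?thesis by blast
qed

context
  assumes one: "\<one>\<^bsub>H\<^esub> \<in> D" and mult: "\<And>d e. d \<in> D \<Longrightarrow> e \<in> D \<Longrightarrow> d \<otimes>\<^bsub>H\<^esub> e \<in> D"
begin

text \<open>These are the one-letter words with index 0 and trivial conjugator. They give continuity
  of \<open>f i\<close> at the identity.\<close>

lemma image_subset_conj_prods:
  assumes V: "nbhd_family V" and i: "i \<in> I"
  shows "f i ` V 0 i \<one>\<^bsub>H\<^esub> \<subseteq> conj_prods V"
proof
  fix y assume "y \<in> f i ` V 0 i \<one>\<^bsub>H\<^esub>"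
  then obtain x where x: "y = f i x" "x \<in> V 0 i \<one>\<^bsub>H\<^esub>" by blast
  then have "y \<in> conj_union (V 0)"
    using conj_unionI[of i "\<one>\<^bsub>H\<^esub>" x "V 0"] one i f_closed family_closed[OF V] by simp
  then show "y \<in> conj_prods V"
    unfolding conj_prods_def using H.subset_distinct_prods[of "\<lambda>k. conj_union (V k)" 0, OF conj_union_closed[OF V]] by blast
qed

text \<open>
  An element \<open>f i g\<close> is \<open>f i u\<close> times some \<open>d \<in> D\<close> with \<open>u\<close> as small as desired, so conjugating
  by it amounts to conjugating by \<open>d\<close> and multiplying by small elements on both sides. This is
  why countably many conjugators suffice.
\<close>

lemma conj_prods_conj_factor:
  assumes dense: "\<And>U. nbhd_of (T i) \<one>\<^bsub>G i\<^esub> U \<Longrightarrow> \<exists>u\<in>U. \<exists>d\<in>D. h = f i u \<otimes>\<^bsub>H\<^esub> d"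
    and i: "i \<in> I" and V: "nbhd_family V"
  shows "\<exists>V'. nbhd_family V' \<and> (\<forall>x\<in>conj_prods V'. h \<otimes>\<^bsub>H\<^esub> x \<otimes>\<^bsub>H\<^esub> inv\<^bsub>H\<^esub> h \<in> conj_prods V)"
proof -
  \<comment> \<open>Conjugation by \<open>f i u * d\<close> yields three factors:
    \<open>f i u\<close>, the conjugate by \<open>d\<close>, and the inverse of
    \<open>f i u\<close>. The first two are to lie in the products for \<open>V2\<close>, hence
    their product in those for \<open>V1\<close>; \<open>V3\<close> puts the inverse there
    too.\<close>
  obtain V1 where V1: "nbhd_family V1" "\<forall>x\<in>conj_prods V1. \<forall>y\<in>conj_prods V1. x \<otimes>\<^bsub>H\<^esub> y \<in> conj_prods V"
    using conj_prods_mult[OF V] by blast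
  obtain V2 where V2: "nbhd_family V2" "\<forall>x\<in>conj_prods V2. \<forall>y\<in>conj_prods V2. x \<otimes>\<^bsub>H\<^esub> y \<in> conj_prods V1"
    using conj_prods_mult[OF V1(1)] by blast
  obtain V3 where V3: "nbhd_family V3" "\<forall>x\<in>conj_prods V3. inv\<^bsub>H\<^esub> x \<in> conj_prods V1"
    using conj_prods_inv[OF V1(1)] by blast
  have "nbhd_of (T i) \<one>\<^bsub>G i\<^esub> (V2 0 i \<one>\<^bsub>H\<^esub> \<inter> V3 0 i \<one>\<^bsub>H\<^esub>)"
    using V2(1) V3(1) i one by (auto simp: nbhd_family_def intro: nbhd_of_Int)
  then obtain u d where u: "u \<in> V2 0 i \<one>\<^bsub>H\<^esub>" "u \<in> V3 0 i \<one>\<^bsub>H\<^esub>" and d: "d \<in> D" and h: "h = f i u \<otimes>\<^bsub>H\<^esub> d"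
    using dense by blast
  obtain V' where V': "nbhd_family V'" "\<forall>x\<in>conj_prods V'. d \<otimes>\<^bsub>H\<^esub> x \<otimes>\<^bsub>H\<^esub> inv\<^bsub>H\<^esub> d \<in> conj_prods V2"
    using conj_prods_conj_submonoid[OF V2(1) d mult[OF d]] by blast
  have fu: "f i u \<in> conj_prods V2" "inv\<^bsub>H\<^esub> (f i u) \<in> conj_prods V1"
    using image_subset_conj_prods[OF V2(1) i] image_subset_conj_prods[OF V3(1) i] u V3(2) by auto
  have c: "f i u \<in> carrier H" "d \<in> carrier H" using fu conj_prods_closed[OF V2(1)] d D by auto
  have "h \<otimes>\<^bsub>H\<^esub> x \<otimes>\<^bsub>H\<^esub> inv\<^bsub>H\<^esub> h \<in> conj_prods V" if x: "x \<in> conj_prods V'" for x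
  proof -
    have "x \<in> carrier H" using x conj_prods_closed[OF V'(1)] by auto
    then have "h \<otimes>\<^bsub>H\<^esub> x \<otimes>\<^bsub>H\<^esub> inv\<^bsub>H\<^esub> h = f i u \<otimes>\<^bsub>H\<^esub> (d \<otimes>\<^bsub>H\<^esub> x \<otimes>\<^bsub>H\<^esub> inv\<^bsub>H\<^esub> d) \<otimes>\<^bsub>H\<^esub> inv\<^bsub>H\<^esub> (f i u)"
      using c by (simp add: h H.inv_mult_group H.m_assoc)
    then show ?thesis using V1 V2 V' fu x by simp
  qed
  with V' show ?thesis by blast
qed

text \<open>Only the conjugation axiom for arbitrary elements remains to be checked. As
  \<open>H\<close> is generated by the images of the factors, it follows by handling one letter at a
  time.\<close>

lemma conj_prods_topology:
  assumes dense: "\<And>i g U. i \<in> I \<Longrightarrow> g \<in> carrier (G i) \<Longrightarrow> nbhd_of (T i) \<one>\<^bsub>G i\<^esub> U \<Longrightarrow>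
      \<exists>u\<in>U. \<exists>d\<in>D. f i g = f i u \<otimes>\<^bsub>H\<^esub> d"
    and gen: "\<And>h. h \<in> carrier H \<Longrightarrow>
      \<exists>w\<in>lists (SIGMA i:I. carrier (G i)). h = list_prod H (map (\<lambda>(i, x). f i x) w)"
  shows "\<exists>S. topological_group H S \<and> (\<forall>i\<in>I. continuous_map (T i) S (f i)) \<and>
           (\<forall>V. nbhd_family V \<longrightarrow> nbhd_of S \<one>\<^bsub>H\<^esub> (conj_prods V))"
proof -
  have conj_word: "\<exists>V'. nbhd_family V' \<and> (\<forall>x\<in>conj_prods V'. h \<otimes>\<^bsub>H\<^esub> x \<otimes>\<^bsub>H\<^esub> inv\<^bsub>H\<^esub> h \<in> conj_prods V)"
    if "w \<in> lists (SIGMA i:I. carrier (G i))" "h = list_prod H (map (\<lambda>(i, x). f i x) w)" "nbhd_family V"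
    for w h V
    using that
  proof (induction w arbitrary: h V rule: lists.induct)
    case Nil
    then have "\<forall>x\<in>conj_prods V. h \<otimes>\<^bsub>H\<^esub> x \<otimes>\<^bsub>H\<^esub> inv\<^bsub>H\<^esub> h \<in> conj_prods V"
      using conj_prods_closed[of V] by auto
    then show ?case using Nil by blast
  next
    case (Cons p w)
    obtain i x where p: "p = (i, x)" "i \<in> I" "x \<in> carrier (G i)" using Cons(1) by auto
    define g where "g = list_prod H (map (\<lambda>(i, x). f i x) w)"
    have "set (map (\<lambda>(i, x). f i x) w) \<subseteq> carrier H" using Cons(2) f_closed by (fastforce simp: lists_eq_set)
    then have g: "g \<in> carrier H" unfolding g_def by (rule H.list_prod_closed)
    have h: "h = f i x \<otimes>\<^bsub>H\<^esub> g" using Cons by (simp add: p g_def)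
    obtain V1 where V1: "nbhd_family V1"
      "\<forall>y\<in>conj_prods V1. f i x \<otimes>\<^bsub>H\<^esub> y \<otimes>\<^bsub>H\<^esub> inv\<^bsub>H\<^esub> (f i x) \<in> conj_prods V"
      \<comment> \<open>Conjugation by \<open>f i x * g\<close> applies \<open>g\<close> first, so
        the target \<open>V\<close> is pulled back through \<open>f i x\<close> to \<open>V1\<close>
        and only then through \<open>g\<close> to \<open>V2\<close>; hence \<open>V\<close> is
        arbitrary in the induction.\<close>
      using conj_prods_conj_factor[OF dense[OF p(2,3)] p(2) Cons.prems(2)] by blast
    obtain V2 where V2: "nbhd_family V2" "\<forall>y\<in>conj_prods V2. g \<otimes>\<^bsub>H\<^esub> y \<otimes>\<^bsub>H\<^esub> inv\<^bsub>H\<^esub> g \<in> conj_prods V1"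
      using Cons.IH[OF g_def V1(1)] by blast
    have "h \<otimes>\<^bsub>H\<^esub> y \<otimes>\<^bsub>H\<^esub> inv\<^bsub>H\<^esub> h \<in> conj_prods V" if y: "y \<in> conj_prods V2" for y
    proof -
      have "y \<in> carrier H" using y conj_prods_closed[OF V2(1)] by auto
      then have "h \<otimes>\<^bsub>H\<^esub> y \<otimes>\<^bsub>H\<^esub> inv\<^bsub>H\<^esub> h = f i x \<otimes>\<^bsub>H\<^esub> (g \<otimes>\<^bsub>H\<^esub> y \<otimes>\<^bsub>H\<^esub> inv\<^bsub>H\<^esub> g) \<otimes>\<^bsub>H\<^esub> inv\<^bsub>H\<^esub> (f i x)"
        using g f_closed[OF p(2,3)] by (simp add: h H.inv_mult_group H.m_assoc)
      then show ?thesis using V1 V2 y by simp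
    qed
    with V2 show ?case by blast
  qed
  have "nbhd_family (\<lambda>_ i _. topspace (T i))"
  proof -
    have "\<one>\<^bsub>G i\<^esub> \<in> topspace (T i)" if "i \<in> I" for i
      using top[OF that] by (simp add: topological_group_def group.is_monoid monoid.one_closed)
    then show ?thesis by (simp add: nbhd_family_def nbhd_of_openin)
  qed
  then have ne: "{conj_prods V | V. nbhd_family V} \<noteq> {}" by blast
  have int: "\<exists>L\<in>{conj_prods V | V. nbhd_family V}. L \<subseteq> conj_prods V \<inter> conj_prods V'"
    if "nbhd_family V" "nbhd_family V'" for V V'
  proof -
    have "nbhd_family (\<lambda>k i d. V k i d \<inter> V' k i d)"
      using that by (auto simp: nbhd_family_def intro: nbhd_of_Int)
    moreover have "conj_prods (\<lambda>k i d. V k i d \<inter> V' k i d) \<subseteq> conj_prods V \<inter> conj_prods V'"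
      by (intro Int_greatest conj_prods_mono) auto
    ultimately show ?thesis by blast
  qed
  have "\<exists>S. topological_group H S \<and> (\<forall>N. nbhd_of S \<one>\<^bsub>H\<^esub> N \<longleftrightarrow>
      N \<subseteq> carrier H \<and> (\<exists>M\<in>{conj_prods V | V. nbhd_family V}. M \<subseteq> N))"
  proof (rule group_topology_from_filter_base[OF H ne], goal_cases)
    case (1 N) then show ?case using conj_prods_closed by blast
  next
    case (2 N) then show ?case using one_in_conj_prods by blast
  next
    case (3 M N)
    then obtain V V' where "M = conj_prods V" "nbhd_family V" "N = conj_prods V'" "nbhd_family V'" by blast
    then show ?case using int by simp
  next
    case (4 N)
    then obtain V where V: "N = conj_prods V" "nbhd_family V" by blast
    show ?case using conj_prods_mult[OF V(2)] unfolding V(1) by blast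
  next
    case (5 N)
    then obtain V where V: "N = conj_prods V" "nbhd_family V" by blast
    show ?case using conj_prods_inv[OF V(2)] unfolding V(1) by blast
  next
    case (6 N g)
    then obtain V where V: "N = conj_prods V" "nbhd_family V" by blast
    obtain w where "w \<in> lists (SIGMA i:I. carrier (G i))" "g = list_prod H (map (\<lambda>(i, x). f i x) w)"
      using gen[OF 6(2)] by blast
    from conj_word[OF this V(2)] show ?case unfolding V(1) by blast
  qed
  then obtain S where tg: "topological_group H S"
    and nbhd: "\<forall>N. nbhd_of S \<one>\<^bsub>H\<^esub> N \<longleftrightarrow>
      N \<subseteq> carrier H \<and> (\<exists>M\<in>{conj_prods V | V. nbhd_family V}. M \<subseteq> N)"
    by (elim exE conjE) (rule that)
  have "continuous_map (T i) S (f i)" if i: "i \<in> I" for i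
  proof (rule continuous_map_hom_if_continuous_at_one[OF top[OF i] tg f[OF i]])
    fix N assume "nbhd_of S \<one>\<^bsub>H\<^esub> N"
    then obtain V where V: "nbhd_family V" "conj_prods V \<subseteq> N" unfolding nbhd[rule_format] by blast
    then have "nbhd_of (T i) \<one>\<^bsub>G i\<^esub> (V 0 i \<one>\<^bsub>H\<^esub>)" using i one by (simp add: nbhd_family_def)
    then show "\<exists>M. nbhd_of (T i) \<one>\<^bsub>G i\<^esub> M \<and> f i ` M \<subseteq> N"
      using image_subset_conj_prods[OF V(1) i] V(2) by blast
  qed
  moreover have "nbhd_of S \<one>\<^bsub>H\<^esub> (conj_prods V)" if "nbhd_family V" for V
    unfolding nbhd[rule_format] using that conj_prods_closed by blast
  ultimately show ?thesis using tg by (intro exI[of _ S] conjI allI ballI impI)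
qed

end

end

text \<open>There are countably many triples \<open>(k, i, d)\<close>, and a countable power of
  \<open>nat \<Rightarrow> nat\<close> with the product order is again
  \<open>nat \<Rightarrow> nat\<close>: one function codes an independent parameter for each
  triple.\<close>

lemma omega_omega_nbhd_families:
  assumes "countable I" "countable D"
    and base: "\<And>i. i \<in> I \<Longrightarrow> has_local_omega_omega_base (G i) (T i)"
  shows "\<exists>V :: (nat \<Rightarrow> nat) \<Rightarrow> nat \<Rightarrow> 'i \<Rightarrow> 'h \<Rightarrow> 'a set.
           (\<forall>\<alpha>. nbhd_family (V \<alpha>)) \<and>
           (\<forall>\<alpha> \<beta> k. \<forall>i\<in>I. \<forall>d\<in>D. \<alpha> \<le> \<beta> \<longrightarrow> V \<beta> k i d \<subseteq> V \<alpha> k i d) \<and>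
           (\<forall>V'. nbhd_family V' \<longrightarrow> (\<exists>\<alpha>. \<forall>k. \<forall>i\<in>I. \<forall>d\<in>D. V \<alpha> k i d \<subseteq> V' k i d))"
proof -
  have "\<exists>U :: (nat \<Rightarrow> nat) \<Rightarrow> 'a set. (\<forall>\<alpha>. nbhd_of (T i) \<one>\<^bsub>G i\<^esub> (U \<alpha>)) \<and>
        (\<forall>\<alpha> \<beta>. \<alpha> \<le> \<beta> \<longrightarrow> U \<beta> \<subseteq> U \<alpha>) \<and> (\<forall>N. nbhd_of (T i) \<one>\<^bsub>G i\<^esub> N \<longrightarrow> (\<exists>\<alpha>. U \<alpha> \<subseteq> N))" if "i \<in> I" for i
    using base[OF that] by (simp add: has_local_omega_omega_base_def)
  then obtain U :: "'i \<Rightarrow> (nat \<Rightarrow> nat) \<Rightarrow> 'a set" where U: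
    "\<And>i \<alpha>. i \<in> I \<Longrightarrow> nbhd_of (T i) \<one>\<^bsub>G i\<^esub> (U i \<alpha>)"
    "\<And>i \<alpha> \<beta>. i \<in> I \<Longrightarrow> \<alpha> \<le> \<beta> \<Longrightarrow> U i \<beta> \<subseteq> U i \<alpha>"
    "\<And>i N. i \<in> I \<Longrightarrow> nbhd_of (T i) \<one>\<^bsub>G i\<^esub> N \<Longrightarrow> \<exists>\<alpha>. U i \<alpha> \<subseteq> N"
    by metis
  have "countable (UNIV \<times> I \<times> D :: (nat \<times> 'i \<times> 'h) set)" using assms by blast
  then obtain e :: "nat \<times> 'i \<times> 'h \<Rightarrow> nat" where e: "inj_on e (UNIV \<times> I \<times> D)"
    unfolding countable_def by blast
  \<comment> \<open>The pairing function cuts \<open>\<alpha>\<close> into rows, and the row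
    numbered \<open>e (k, i, d)\<close> is the parameter for that triple. Each row depends
    monotonically on \<open>\<alpha>\<close>.\<close>
  define V where "V \<alpha> k i d = U i (\<lambda>m. \<alpha> (prod_encode (e (k, i, d), m)))" for \<alpha> k i d
  have fam: "nbhd_family (V \<alpha>)" for \<alpha> using U(1) by (simp add: nbhd_family_def V_def)
  have anti: "V \<beta> k i d \<subseteq> V \<alpha> k i d" if "\<alpha> \<le> \<beta>" "i \<in> I" for \<alpha> \<beta> k i d
    unfolding V_def using that by (intro U(2)) (auto simp: le_fun_def)
  have cofinal: "\<exists>\<alpha>. \<forall>k. \<forall>i\<in>I. \<forall>d\<in>D. V \<alpha> k i d \<subseteq> V' k i d" if V': "nbhd_family V'" for V'
  proof -
    have "\<exists>\<gamma>. p \<in> UNIV \<times> I \<times> D \<longrightarrow> U (fst (snd p)) \<gamma> \<subseteq> V' (fst p) (fst (snd p)) (snd (snd p))" for p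
      using U(3) V' by (cases p) (auto simp: nbhd_family_def)
    then obtain \<gamma> where \<gamma>: "\<And>p. p \<in> UNIV \<times> I \<times> D \<Longrightarrow>
        U (fst (snd p)) (\<gamma> p) \<subseteq> V' (fst p) (fst (snd p)) (snd (snd p))"
      by metis
    \<comment> \<open>The chosen parameters are written into their rows. Rows whose number is not a
      value of \<open>e\<close> receive arbitrary contents and are never read.\<close>
    define \<alpha> where "\<alpha> n = (case prod_decode n of (j, m) \<Rightarrow> \<gamma> (inv_into (UNIV \<times> I \<times> D) e j) m)" for n
    have "V \<alpha> k i d \<subseteq> V' k i d" if "i \<in> I" "d \<in> D" for k i d
      using \<gamma>[of "(k, i, d)"] that by (simp add: V_def \<alpha>_def inv_into_f_f[OF e])
    then show ?thesis by blast
  qed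
  show ?thesis
    by (intro exI[of _ V] conjI allI ballI impI fam anti cofinal)
qed

end

section \<open>The free product\<close>

lemma first_countable_imp_local_omega_omega_base:
  assumes T: "topological_group G T" and fc: "first_countable T"
  shows "has_local_omega_omega_base G T"
proof -
  have one: "\<one>\<^bsub>G\<^esub> \<in> topspace T"
    using T by (simp add: topological_group_def group.is_monoid monoid.one_closed)
  then obtain \<B> where \<B>: "countable \<B>" "\<And>V. V \<in> \<B> \<Longrightarrow> openin T V"
    "\<And>U. openin T U \<Longrightarrow> \<one>\<^bsub>G\<^esub> \<in> U \<Longrightarrow> \<exists>V\<in>\<B>. \<one>\<^bsub>G\<^esub> \<in> V \<and> V \<subseteq> U"
    using fc unfolding first_countable_def by meson
  let ?B = "{V \<in> \<B>. \<one>\<^bsub>G\<^esub> \<in> V}"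
  define b where "b = from_nat_into ?B"
  have cne: "countable ?B" "?B \<noteq> {}" using \<B>(1) \<B>(3)[OF openin_topspace one] by auto
  then have b: "b n \<in> ?B" for n unfolding b_def by (intro from_nat_into)
  have surj: "\<exists>n. b n = V" if "V \<in> ?B" for V
    unfolding b_def using from_nat_into_surj[OF cne(1) that] .
  \<comment> \<open>Only the value of \<open>\<alpha>\<close> at 0 matters. Intersecting all
    \<open>b k\<close> up to it makes \<open>U\<close> antitone, and finiteness of the intersection
    keeps it open.\<close>
  define U where "U \<alpha> = (\<Inter>k\<le>\<alpha> 0. b k)" for \<alpha> :: "nat \<Rightarrow> nat"
  have "nbhd_of T \<one>\<^bsub>G\<^esub> (U \<alpha>)" for \<alpha>
    unfolding U_def using b \<B>(2) by (intro nbhd_of_openin openin_Inter) auto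
  moreover have "U \<beta> \<subseteq> U \<alpha>" if "\<alpha> \<le> \<beta>" for \<alpha> \<beta>
    unfolding U_def using le_funD[OF that, of 0] by (intro INT_anti_mono) auto
  moreover have "\<exists>\<alpha>. U \<alpha> \<subseteq> N" if N: "nbhd_of T \<one>\<^bsub>G\<^esub> N" for N
  proof -
    obtain n where "b n \<subseteq> N" using N \<B>(3) surj unfolding nbhd_of_def by (metis (mono_tags, lifting) mem_Collect_eq subset_trans)
    then have "U (\<lambda>_. n) \<subseteq> N" by (auto simp: U_def)
    then show ?thesis by blast
  qed
  ultimately show ?thesis unfolding has_local_omega_omega_base_def by blast
qed

text \<open>The finest topology was taken among those that embed the factors, while here the
  inclusions into \<open>S\<close> are only continuous. The join of \<open>S\<close> with the free
  product topology is again a group topology and embeds the factors because the latter does, so it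
  is one of the competitors.\<close>

lemma free_product_topology_coarser:
  assumes top: "\<And>i. i \<in> I \<Longrightarrow> topological_group (G i) (T i)"
    and S: "topological_group (free_product I G) S"
    and cont: "\<And>i. i \<in> I \<Longrightarrow> continuous_map (T i) S (fp_incl I G i)"
    and U: "openin S U"
  shows "openin (free_product_topology I G T) U"
proof -
  let ?\<tau> = "free_product_topology I G T"
  let ?\<F> = "{S, ?\<tau>}"
  let ?R = "topology_generated_by {U. \<exists>S\<in>?\<F>. openin S U}"
  have \<tau>: "topological_group (free_product I G) ?\<tau>"
    "\<And>i. i \<in> I \<Longrightarrow> embedding_map (T i) ?\<tau> (fp_incl I G i)"
    using free_product_topology_finest(1)[of I G T, OF top] by (auto simp: fp_group_topology_def)
  have "topological_group (free_product I G) ?R"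
    by (rule topological_group_sup) (use S \<tau> in auto)
  moreover have "embedding_map (T i) ?R (fp_incl I G i)" if i: "i \<in> I" for i
  proof (rule embedding_map_sup[where S = ?\<tau>])
    have "continuous_map (T i) ?\<tau> (fp_incl I G i)"
      using homeomorphic_imp_continuous_map[OF \<tau>(2)[OF i, unfolded embedding_map_def]]
      by (rule continuous_map_into_fulltopology)
    then show "continuous_map (T i) R (fp_incl I G i)" if "R \<in> ?\<F>" for R
      using that cont[OF i] by auto
  qed (use \<tau> i in auto)
  ultimately have "fp_group_topology I G T ?R" by (simp add: fp_group_topology_def)
  moreover have "openin ?R U" using U by (auto intro: topology_generated_by_Basis)
  ultimately show ?thesis using free_product_topology_finest(2)[of I G T, OF top] by blast
qed

text \<open>Supplies the fact that the images of the factors generate the free product.\<close>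

lemma fp_class_eq_list_prod:
  assumes G: "\<And>i. i \<in> I \<Longrightarrow> group (G i)" and w: "w \<in> fp_words I G"
  shows "fp_class I G w = list_prod (free_product I G) (map (\<lambda>(i, x). fp_incl I G i x) w)"
  using w
proof (induction w)
  case Nil
  then show ?case by (simp add: free_product_simps[of I G, OF G])
next
  case (Cons p w)
  obtain i x where p: "p = (i, x)" by fastforce
  have "fp_incl I G i x \<otimes>\<^bsub>free_product I G\<^esub> fp_class I G w = fp_class I G ([(i, x)] @ w)"
    unfolding fp_incl_def by (rule free_product_mult) (use G Cons p in auto)
  then show ?case using Cons p by simp
qed

text \<open>The elements \<open>y\<close> with \<open>g * inv y\<close> in the interior of
  \<open>U\<close> form an open set containing \<open>g\<close>, so the dense set meets it; then
  \<open>u\<close> is \<open>g * inv y\<close>.\<close>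

lemma dense_topological_group_factor:
  assumes T: "topological_group G T" and C: "T closure_of C = topspace T"
    and g: "g \<in> carrier G" and U: "nbhd_of T \<one>\<^bsub>G\<^esub> U"
  shows "\<exists>u\<in>U. \<exists>y\<in>C \<inter> carrier G. g = u \<otimes>\<^bsub>G\<^esub> y"
proof -
  interpret group G using T by (simp add: topological_group_def)
  have sp: "topspace T = carrier G" and inv: "continuous_map T T (\<lambda>x. inv\<^bsub>G\<^esub> x)"
    using T by (auto simp: topological_group_def)
  obtain V where V: "openin T V" "\<one>\<^bsub>G\<^esub> \<in> V" "V \<subseteq> U" using U by (auto simp: nbhd_of_def)
  have "continuous_map T T (\<lambda>y. g \<otimes>\<^bsub>G\<^esub> inv\<^bsub>G\<^esub> y)"
    using continuous_map_compose[OF inv topological_group_continuous_translations(1)[OF T g]]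
    by (simp add: o_def)
  then have "openin T {y \<in> topspace T. g \<otimes>\<^bsub>G\<^esub> inv\<^bsub>G\<^esub> y \<in> V}"
    using V(1) by (rule openin_continuous_map_preimage)
  moreover have "g \<in> {y \<in> topspace T. g \<otimes>\<^bsub>G\<^esub> inv\<^bsub>G\<^esub> y \<in> V}" using g sp V by simp
  ultimately obtain y where y: "y \<in> C" "y \<in> carrier G" "g \<otimes>\<^bsub>G\<^esub> inv\<^bsub>G\<^esub> y \<in> V"
    using C sp unfolding dense_intersects_open by blast
  have "g = g \<otimes>\<^bsub>G\<^esub> inv\<^bsub>G\<^esub> y \<otimes>\<^bsub>G\<^esub> y" using g y by (simp add: m_assoc)
  then show ?thesis using y V by blast
qed

theorem free_product_local_omega_omega_base:
  fixes I :: "'i set" and G :: "'i \<Rightarrow> ('a, 'b) monoid_scheme"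
  assumes I: "countable I"
    and top: "\<And>i. i \<in> I \<Longrightarrow> topological_group (G i) (T i)"
    and sep: "\<And>i. i \<in> I \<Longrightarrow> separable_space (T i)"
    and base: "\<And>i. i \<in> I \<Longrightarrow> has_local_omega_omega_base (G i) (T i)"
  shows "has_local_omega_omega_base (free_product I G) (free_product_topology I G T)"
proof -
  let ?F = "free_product I G" and ?\<tau> = "free_product_topology I G T" and ?f = "fp_incl I G"
  have grp: "\<And>i. i \<in> I \<Longrightarrow> group (G i)" using top by (simp add: topological_group_def)
  have F: "group ?F" using group_free_product[of I G] grp by blast
  note f = fp_incl_hom[of I G, OF grp]
  have "\<exists>C. countable C \<and> T i closure_of C = topspace (T i)" if "i \<in> I" for i
    using sep[OF that] unfolding separable_space_def by blast
  then obtain C where C: "\<And>i. i \<in> I \<Longrightarrow> countable (C i)" "\<And>i. i \<in> I \<Longrightarrow> T i closure_of C i = topspace (T i)"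
    by metis
  \<comment> \<open>Classes of words with letters from the countable dense sets: countable because
    finite lists over a countable set are, and a submonoid because words are concatenated.\<close>
  define D where "D = fp_class I G ` lists (SIGMA i:I. C i \<inter> carrier (G i))"
  have words: "lists (SIGMA i:I. C i \<inter> carrier (G i)) \<subseteq> fp_words I G"
    unfolding fp_words_def by (intro lists_mono) auto
  have D: "D \<subseteq> carrier ?F" using words by (auto simp: D_def free_product_simps[of I G, OF grp])
  have "countable D" unfolding D_def using I C(1) by (intro countable_image countable_lists countable_SIGMA) auto
  have one: "\<one>\<^bsub>?F\<^esub> \<in> D" by (simp add: D_def free_product_simps[of I G, OF grp])
  have mult: "d \<otimes>\<^bsub>?F\<^esub> e \<in> D" if "d \<in> D" "e \<in> D" for d e
  proof -
    obtain u where u: "d = fp_class I G u" "u \<in> lists (SIGMA i:I. C i \<inter> carrier (G i))"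
      using \<open>d \<in> D\<close> unfolding D_def by (rule imageE)
    obtain v where v: "e = fp_class I G v" "v \<in> lists (SIGMA i:I. C i \<inter> carrier (G i))"
      using \<open>e \<in> D\<close> unfolding D_def by (rule imageE)
    from u v have "d \<otimes>\<^bsub>?F\<^esub> e = fp_class I G (u @ v)"
      using free_product_mult[of I G u v, OF grp] subsetD[OF words] by simp
    moreover have "u @ v \<in> lists (SIGMA i:I. C i \<inter> carrier (G i))" using u(2) v(2) by simp
    ultimately show ?thesis unfolding D_def by (rule image_eqI)
  qed
  have dense: "\<exists>u\<in>U. \<exists>d\<in>D. ?f i g = ?f i u \<otimes>\<^bsub>?F\<^esub> d"
    if i: "i \<in> I" and g: "g \<in> carrier (G i)" and U: "nbhd_of (T i) \<one>\<^bsub>G i\<^esub> U" for i g U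
  proof -
    obtain u y where uy: "u \<in> U" "y \<in> C i \<inter> carrier (G i)" "g = u \<otimes>\<^bsub>G i\<^esub> y"
      using dense_topological_group_factor[OF top[OF i] C(2)[OF i] g U] by blast
    have "u \<in> carrier (G i)" using nbhd_ofD(2)[OF U] uy top[OF i] by (auto simp: topological_group_def)
    then have "?f i g = ?f i u \<otimes>\<^bsub>?F\<^esub> ?f i y" using hom_mult[OF f[OF _ i]] uy by simp
    moreover have "?f i y \<in> D" unfolding D_def fp_incl_def using uy i by (intro imageI) auto
    ultimately show ?thesis using uy by blast
  qed
  have gen: "\<exists>w\<in>lists (SIGMA i:I. carrier (G i)). h = list_prod ?F (map (\<lambda>(i, x). ?f i x) w)"
    if "h \<in> carrier ?F" for h
    using that fp_class_eq_list_prod[of I G, OF grp]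
    by (auto simp: free_product_simps[of I G, OF grp] fp_words_def)
  obtain S where S: "topological_group ?F S" "\<And>i. i \<in> I \<Longrightarrow> continuous_map (T i) S (?f i)"
    "\<And>V. nbhd_family I D G T V \<Longrightarrow> nbhd_of S \<one>\<^bsub>?F\<^esub> (conj_prods ?F I D ?f V)"
    using conj_prods_topology[of ?F I G T ?f D, OF F top f D one mult dense gen] by blast
  have \<tau>: "topological_group ?F ?\<tau>" "\<And>i. i \<in> I \<Longrightarrow> embedding_map (T i) ?\<tau> (?f i)"
    using free_product_topology_finest(1)[of I G T, OF top] by (auto simp: fp_group_topology_def)
  \<comment> \<open>\<open>S\<close> is coarser than the free product topology, so its
    neighbourhoods of the identity remain neighbourhoods there.\<close>
  have "nbhd_of ?\<tau> \<one>\<^bsub>?F\<^esub> N" if "nbhd_of S \<one>\<^bsub>?F\<^esub> N" for N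
    using that free_product_topology_coarser[of I G T, OF top S(1,2)] S(1) \<tau>(1)
    by (auto simp: nbhd_of_def topological_group_def)
  with S(3) have nbhd: "nbhd_of ?\<tau> \<one>\<^bsub>?F\<^esub> (conj_prods ?F I D ?f V)" if "nbhd_family I D G T V" for V
    using that by blast
  have cont: "continuous_map (T i) ?\<tau> (?f i)" if "i \<in> I" for i
    using homeomorphic_imp_continuous_map[OF \<tau>(2)[OF that, unfolded embedding_map_def]]
    by (rule continuous_map_into_fulltopology)
  \<comment> \<open>The cube argument applies to the free product topology itself, so the products
    of conjugates form a base at its identity and not only at that of \<open>S\<close>.\<close>
  have small: "\<exists>V. nbhd_family I D G T V \<and> conj_prods ?F I D ?f V \<subseteq> N" if "nbhd_of ?\<tau> \<one>\<^bsub>?F\<^esub> N" for N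
    using conj_prods_subset_nbhd[of ?F I G T ?f D, OF F top f D \<tau>(1) cont that] by blast
  obtain V where V: "\<And>\<alpha>. nbhd_family I D G T (V \<alpha>)"
    "\<And>\<alpha> \<beta> k i d. i \<in> I \<Longrightarrow> d \<in> D \<Longrightarrow> \<alpha> \<le> \<beta> \<Longrightarrow> V \<beta> k i d \<subseteq> V \<alpha> k i d"
    "\<And>V'. nbhd_family I D G T V' \<Longrightarrow> \<exists>\<alpha> :: nat \<Rightarrow> nat. \<forall>k. \<forall>i\<in>I. \<forall>d\<in>D. V \<alpha> k i d \<subseteq> V' k i d"
    using omega_omega_nbhd_families[OF I \<open>countable D\<close>, of G T, OF base] by metis
  show ?thesis
    unfolding has_local_omega_omega_base_def
  proof (intro exI[of _ "\<lambda>\<alpha>. conj_prods ?F I D ?f (V \<alpha>)"] conjI allI impI)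
    show "nbhd_of ?\<tau> \<one>\<^bsub>?F\<^esub> (conj_prods ?F I D ?f (V \<alpha>))" for \<alpha> using nbhd V(1) by blast
    show "conj_prods ?F I D ?f (V \<beta>) \<subseteq> conj_prods ?F I D ?f (V \<alpha>)" if "\<alpha> \<le> \<beta>" for \<alpha> \<beta>
      by (rule conj_prods_mono) (use V(2) that in blast)
    fix N assume "nbhd_of ?\<tau> \<one>\<^bsub>?F\<^esub> N"
    then obtain V' where V': "nbhd_family I D G T V'" "conj_prods ?F I D ?f V' \<subseteq> N"
      using small by blast
    obtain \<alpha> :: "nat \<Rightarrow> nat" where "\<forall>k. \<forall>i\<in>I. \<forall>d\<in>D. V \<alpha> k i d \<subseteq> V' k i d" using V(3)[OF V'(1)] by blast
    then have "conj_prods ?F I D ?f (V \<alpha>) \<subseteq> conj_prods ?F I D ?f V'" by (intro conj_prods_mono) blast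
    with V'(2) show "\<exists>\<alpha>. conj_prods ?F I D ?f (V \<alpha>) \<subseteq> N" by blast
  qed
qed

theorem corollary3p7:
  shows "(\<forall>(G :: nat \<Rightarrow> 'a monoid) (T :: nat \<Rightarrow> 'a topology).
            (\<forall>n. topological_group (G n) (T n) \<and> separable_space (T n) \<and>
                 has_local_omega_omega_base (G n) (T n)) \<longrightarrow>
            has_local_omega_omega_base (free_product UNIV G) (free_product_topology UNIV G T))
       \<and> (\<forall>(I :: 'i set) (G :: 'i \<Rightarrow> 'b monoid) (T :: 'i \<Rightarrow> 'b topology).
            countable I \<and> (\<forall>i\<in>I. polish_group (G i) (T i)) \<longrightarrow>
            has_local_omega_omega_base (free_product I G) (free_product_topology I G T))"
proof (intro conjI allI impI)
  fix G :: "nat \<Rightarrow> 'a monoid" and T :: "nat \<Rightarrow> 'a topology"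
  assume "\<forall>n. topological_group (G n) (T n) \<and> separable_space (T n) \<and> has_local_omega_omega_base (G n) (T n)"
  then show "has_local_omega_omega_base (free_product UNIV G) (free_product_topology UNIV G T)"
    by (intro free_product_local_omega_omega_base) auto
next
  fix I :: "'i set" and G :: "'i \<Rightarrow> 'b monoid" and T :: "'i \<Rightarrow> 'b topology"
  assume *: "countable I \<and> (\<forall>i\<in>I. polish_group (G i) (T i))"
  \<comment> \<open>Polish groups are metrizable, hence first countable, and so have the required
    base.\<close>
  have "first_countable (T i)" if "i \<in> I" for i
    using * that by (auto simp: polish_group_def intro: completely_metrizable_imp_metrizable_space metrizable_imp_first_countable)
  with * show "has_local_omega_omega_base (free_product I G) (free_product_topology I G T)"
    by (intro free_product_local_omega_omega_base first_countable_imp_local_omega_omega_base)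
       (auto simp: polish_group_def)
qed

end
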